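(* Let $p$ be a prime, $f\ge1$, $q=p^f$. Suppose that for every integer $k$ with $1\le k\le q-1$, every $d\ge1$, every $e\ge0$ with $p^e\mid d$ and $p^e\ge q$, and every $[g_q(k,d),k,d]_q$ Griesmer code $C$, the integer $p^{e+1}/q$ divides $\mathrm{wt}(c)$ for all $c\in C$. Then the same conclusion holds for every $k\ge1$: for every $[g_q(k,d),k,d]_q$ Griesmer code $C$ and every $e$ with $p^e\mid d$ and $p^e\ge q$, $p^{e+1}/q$ divides $\mathrm{wt}(c)$ for all $c\in C$.
   Context: An $[n,k,d]_q$ code is a $k$-dimensional subspace of $\mathbb{F}_q^n$ with minimum nonzero Hamming weight $d$; $\mathrm{wt}(c)$ is the number of nonzero coordinates of $c$. $g_q(k,d)=\sum_{i=0}^{k-1}\lceil d/q^i\rceil$, and a code of length $g_q(k,d)$ is a Griesmer code. Codes are assumed to have full length. *)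

theory Defs
  imports Complex_Main "HOL-Library.Cardinality" "HOL-Library.Function_Algebras" "HOL-Computational_Algebra.Primes"
begin

text \<open>
  The length of a code varies within a single statement, so \<open>F_q^n\<close> cannot be indexed by a type.
  A vector of \<open>F_q^n\<close> is a function \<open>nat \<Rightarrow> 'a\<close> that vanishes outside \<open>{..<n}\<close>. All these spaces
  lie in the one vector space \<open>nat \<Rightarrow> 'a\<close>, from which subspaces and dimensions are taken.
\<close>

definition vscale :: "'a::field \<Rightarrow> (nat \<Rightarrow> 'a) \<Rightarrow> nat \<Rightarrow> 'a" where
  "vscale a v = (\<lambda>i. a * v i)"

global_interpretation fvec: vector_space "vscale :: 'a::field \<Rightarrow> (nat \<Rightarrow> 'a) \<Rightarrow> nat \<Rightarrow> 'a"
  by unfold_locales (auto simp: vscale_def fun_eq_iff algebra_simps)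

definition coord_space :: "nat \<Rightarrow> (nat \<Rightarrow> 'a::field) set" where
  "coord_space n = {v. \<forall>i\<ge>n. v i = 0}"

definition hamming_weight :: "(nat \<Rightarrow> 'a::zero) \<Rightarrow> nat" where
  "hamming_weight v = card {i. v i \<noteq> 0}"

definition full_length :: "nat \<Rightarrow> (nat \<Rightarrow> 'a::zero) set \<Rightarrow> bool" where
  "full_length n C \<longleftrightarrow> (\<forall>i<n. \<exists>c\<in>C. c i \<noteq> 0)"

definition is_min_weight :: "(nat \<Rightarrow> 'a::zero) set \<Rightarrow> nat \<Rightarrow> bool" where
  "is_min_weight C d \<longleftrightarrow>
     (\<exists>c\<in>C - {0}. hamming_weight c = d) \<and> (\<forall>c\<in>C - {0}. d \<le> hamming_weight c)"

text \<open>\<open>[n,k,d]_q\<close> codes with \<open>q = CARD('a)\<close>; full length is part of the notion.\<close>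

definition linear_code :: "nat \<Rightarrow> nat \<Rightarrow> nat \<Rightarrow> (nat \<Rightarrow> 'a::{field,finite}) set \<Rightarrow> bool" where
  "linear_code n k d C \<longleftrightarrow>
     C \<subseteq> coord_space n \<and> fvec.subspace C \<and> fvec.dim C = k \<and> is_min_weight C d \<and> full_length n C"

definition griesmer_length :: "nat \<Rightarrow> nat \<Rightarrow> nat \<Rightarrow> nat" where
  "griesmer_length q k d = (\<Sum>i<k. nat \<lceil>real d / real q ^ i\<rceil>)"

definition griesmer_code :: "nat \<Rightarrow> nat \<Rightarrow> (nat \<Rightarrow> 'a::{field,finite}) set \<Rightarrow> bool" where
  "griesmer_code k d C \<longleftrightarrow> linear_code (griesmer_length CARD('a) k d) k d C"

end

(*
  Shortening a Griesmer code C at a coordinate of maximal multiplicity ceil(d / q^(k-1)) gives a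
  Griesmer code with the same d and dimension k - 1. So by induction every word with a zero in the
  set S of these coordinates has weight divisible by Delta = p^(e+1)/q. Let c have no zero in S. If
  some z in C takes on S every value of the ratio z_i / c_i, then every word z - a c has a zero in S,
  and summing weights along this line gives  wt(c) = q |supp <c, z>|  (mod Delta).

  If e < 2f, then Delta divides q, and such a z exists because S spans: it contains k >= q independent
  coordinates, at which z can be prescribed freely. If e >= 2f, then q^2 | d. For k = 2 all weights
  are d; for k >= 3 repeated shortening leaves a three-dimensional subcode D of constant weight d.
  A second moment count over D finds z in D with all ratios, and q |supp <c, z>| is divisible by
  Delta because the residual code of C with respect to the minimum weight word z is a Griesmer code
  with parameters k - 1 and d / q, to which the induction applies with e - f.
*)
theory Submission
  imports Defs "HOL-Library.FuncSet"
begin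

subsection \<open>Subspaces, supports and cardinalities\<close>

lemma vscale_apply: "vscale a v i = a * v i"
  by (simp add: vscale_def)

lemma zero_fun_iff: "x = 0 \<longleftrightarrow> (\<forall>i. x i = 0)" for x :: "nat \<Rightarrow> 'a::zero"
  by (auto simp: fun_eq_iff)

definition code_supp :: "(nat \<Rightarrow> 'a::zero) set \<Rightarrow> nat set" where
  "code_supp C = {i. \<exists>c\<in>C. c i \<noteq> 0}"

definition shorten :: "(nat \<Rightarrow> 'a::zero) set \<Rightarrow> nat \<Rightarrow> (nat \<Rightarrow> 'a) set" where
  "shorten C i = {c\<in>C. c i = 0}"

lemma shorten_subset: "shorten C i \<subseteq> C"
  by (auto simp: shorten_def)

lemma code_supp_mono: "D \<subseteq> C \<Longrightarrow> code_supp D \<subseteq> code_supp C"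
  by (auto simp: code_supp_def)

lemma subspace_shorten:
  fixes C :: "(nat \<Rightarrow> 'a::field) set"
  assumes "fvec.subspace C"
  shows "fvec.subspace (shorten C i)"
  using assms by (auto simp: fvec.subspace_def shorten_def vscale_apply)

lemma hamming_weight_eq_0_iff:
  assumes "finite {i. x i \<noteq> 0}"
  shows "hamming_weight x = 0 \<longleftrightarrow> x = 0"
  using assms by (auto simp: hamming_weight_def zero_fun_iff)

lemma finite_word_supp:
  assumes "finite (code_supp C)" "x \<in> C"
  shows "finite {i. x i \<noteq> 0}"
  by (rule finite_subset[OF _ assms(1)]) (use assms(2) in \<open>auto simp: code_supp_def\<close>)

section \<open>Cardinalities of codes, used in place of dimensions\<close>

lemma q_ge_2: "CARD('a::{field,finite}) \<ge> 2"
proof -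
  have "card {0, 1 :: 'a} \<le> CARD('a)"
    by (rule card_mono) auto
  then show ?thesis by simp
qed

text \<open>All fibres over the image are translates of the kernel. The codomain is left general, so
  that this serves for coordinates, for the form \<open>g i * c j - g j * c i\<close> and for the
  residual map \<open>off_supp g\<close>.\<close>

lemma card_additive_image:
  fixes f :: "(nat \<Rightarrow> 'a::field) \<Rightarrow> 'b::ab_group_add"
  assumes C: "fvec.subspace C" "finite C"
    and f: "\<And>x y. x \<in> C \<Longrightarrow> y \<in> C \<Longrightarrow> f (x - y) = f x - f y"
  shows "card C = card (f ` C) * card {x\<in>C. f x = 0}"
proof -
  have f_add: "f (x + y) = f x + f y" if "x \<in> C" "y \<in> C" for x y
    using f[of "x + y" y] that C(1) fvec.subspace_add[OF C(1)] by simp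
  have "card {x\<in>C. f x = b} = card {x\<in>C. f x = 0}" if b: "b \<in> f ` C" for b
  proof -
    from b obtain y where y: "y \<in> C" "b = f y" by auto
    have "bij_betw (\<lambda>x. x + y) {x\<in>C. f x = 0} {x\<in>C. f x = b}"
      by (rule bij_betw_byWitness[where f' = "\<lambda>x. x - y"])
        (use y f f_add fvec.subspace_add[OF C(1)] fvec.subspace_diff[OF C(1)] in auto)
    then show ?thesis by (simp add: bij_betw_same_card)
  qed
  moreover have "card C = (\<Sum>b\<in>f ` C. card {x\<in>C. f x = b})"
    using sum.group[of C "f ` C" f "\<lambda>_. 1::nat"] C(2) by simp
  ultimately show ?thesis by simp
qed

lemma card_eq_card_shorten:
  fixes C :: "(nat \<Rightarrow> 'a::{field,finite}) set"
  assumes C: "fvec.subspace C" "finite C" and i: "i \<in> code_supp C"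
  shows "card C = CARD('a) * card (shorten C i)"
proof -
  from i obtain c where c: "c \<in> C" "c i \<noteq> 0" by (auto simp: code_supp_def)
  have "a \<in> (\<lambda>x. x i) ` C" for a
  proof -
    have "vscale (a / c i) c \<in> C" using C(1) c(1) by (rule fvec.subspace_scale)
    then show ?thesis using c(2) by (force simp: vscale_apply intro: rev_image_eqI)
  qed
  then have "(\<lambda>x. x i) ` C = UNIV" by auto
  then show ?thesis
    using card_additive_image[OF C, of "\<lambda>x. x i"] by (simp add: shorten_def)
qed

lemma card_shorten_pow:
  fixes C :: "(nat \<Rightarrow> 'a::{field,finite}) set"
  assumes "fvec.subspace C" "card C = CARD('a) ^ Suc k" "i \<in> code_supp C"
  shows "card (shorten C i) = CARD('a) ^ k"
proof -
  have "finite C" using assms(2) card_gt_0_iff[of C] by simp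
  then show ?thesis using card_eq_card_shorten[OF assms(1) _ assms(3)] assms(2) by simp
qed

text \<open>The representation \<open>vscale a b + y\<close> with \<open>y\<close> in
  \<open>D\<close> is unique: two different scalars would put \<open>b\<close> into
  \<open>D\<close>.\<close>

lemma card_span_insert:
  fixes D :: "(nat \<Rightarrow> 'a::{field,finite}) set"
  assumes D: "fvec.subspace D" "finite D" and b: "b \<notin> D"
  shows "finite (fvec.span (insert b D)) \<and> card (fvec.span (insert b D)) = CARD('a) * card D"
proof -
  let ?f = "\<lambda>(a, y). vscale a b + y"
  have [simp]: "fvec.span D = D" using D(1) by (simp add: fvec.span_eq_iff)
  have "inj_on ?f (UNIV \<times> D)"
  proof (rule inj_onI, clarsimp)
    fix a y a' y'
    assume y: "y \<in> D" "y' \<in> D" and eq: "vscale a b + y = vscale a' b + y'"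
    have "vscale (a - a') b = y' - y"
      using eq by (simp add: fvec.scale_left_diff_distrib algebra_simps)
    then have "vscale (a - a') b \<in> D"
      using y D(1) by (simp add: fvec.subspace_diff)
    moreover have "b = vscale (1 / (a - a')) (vscale (a - a') b)" if "a \<noteq> a'"
      using that by (simp add: fun_eq_iff vscale_apply)
    ultimately have "a = a'"
      using b D(1) fvec.subspace_scale by metis
    then show "a = a' \<and> y = y'" using eq by simp
  qed
  moreover have "fvec.span (insert b D) = ?f ` (UNIV \<times> D)"
  proof (intro equalityI subsetI)
    fix x assume "x \<in> fvec.span (insert b D)"
    then obtain a where "x - vscale a b \<in> D"
      by (auto simp: fvec.span_insert)
    then show "x \<in> ?f ` (UNIV \<times> D)"
      by (intro image_eqI[where x = "(a, x - vscale a b)"]) auto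
  next
    fix x assume "x \<in> ?f ` (UNIV \<times> D)"
    then obtain a y where "x = vscale a b + y" "y \<in> D" by auto
    then have "x - vscale a b \<in> D" by simp
    then show "x \<in> fvec.span (insert b D)"
      by (auto simp: fvec.span_insert)
  qed
  ultimately show ?thesis
    using D(2) by (simp add: card_image card_cartesian_product finite_cartesian_product)
qed

text \<open>Exchanges dimension for cardinality, which is easier to follow through shortening and
  quotients.\<close>

lemma card_subspace_eq_dim:
  fixes C :: "(nat \<Rightarrow> 'a::{field,finite}) set"
  assumes C: "fvec.subspace C" "finite C"
  shows "card C = CARD('a) ^ fvec.dim C"
proof -
  have span: "finite (fvec.span B) \<and> card (fvec.span B) = CARD('a) ^ card B"
    if "finite B" "fvec.independent B" for B :: "(nat \<Rightarrow> 'a) set"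
    using that
  proof (induction B)
    case (insert b B)
    have "fvec.independent B" "b \<notin> fvec.span B"
      using insert.prems insert.hyps by (auto simp: fvec.independent_insert)
    moreover have "fvec.span (insert b (fvec.span B)) = fvec.span (insert b B)"
      by (simp only: fvec.span_insert fvec.span_span)
    ultimately show ?case
      using insert card_span_insert[of "fvec.span B" b] by simp
  qed simp
  obtain B where B: "B \<subseteq> C" "fvec.independent B" "C \<subseteq> fvec.span B" "card B = fvec.dim C"
    using fvec.basis_exists by metis
  have "fvec.span B = C"
    using B C(1) by (metis fvec.span_minimal subset_antisym)
  then show ?thesis using span[of B] B C(2) finite_subset by metis
qed

subsection \<open>Weight identities\<close>

text \<open>Count at each coordinate. Where \<open>y i\<close> is nonzero, exactly one
  \<open>a\<close> kills \<open>x i + a * y i\<close>, and the extra term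
  \<open>hamming_weight y\<close> makes up for it; where only \<open>x i\<close> is nonzero, every
  \<open>a\<close> counts.\<close>

lemma sum_weight_line:
  fixes x y :: "nat \<Rightarrow> 'a::{field,finite}"
  assumes x: "finite {i. x i \<noteq> 0}" and y: "finite {i. y i \<noteq> 0}"
  shows "(\<Sum>a\<in>UNIV. hamming_weight (x + vscale a y)) + hamming_weight y
       = CARD('a) * card {i. x i \<noteq> 0 \<or> y i \<noteq> 0}"
proof -
  let ?U = "{i. x i \<noteq> 0 \<or> y i \<noteq> 0}"
  have U: "finite ?U" using finite_UnI[OF x y] by (simp add: Collect_disj_eq del: disj_not1)
  have wt: "hamming_weight z = (\<Sum>i\<in>?U. of_bool (z i \<noteq> 0))" if "\<And>i. z i \<noteq> 0 \<Longrightarrow> i \<in> ?U" for z :: "nat \<Rightarrow> 'a"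
  proof -
    have "{i. z i \<noteq> 0} = ?U \<inter> {i. z i \<noteq> 0}" using that by auto
    then have "hamming_weight z = card (?U \<inter> {i. z i \<noteq> 0})" by (simp add: hamming_weight_def)
    then show ?thesis using U by (simp add: sum_of_bool_eq)
  qed
  have pt: "(\<Sum>a\<in>UNIV. of_bool (x i + a * y i \<noteq> 0)) + of_bool (y i \<noteq> 0) = CARD('a)"
    if i: "i \<in> ?U" for i
  proof (cases "y i = 0")
    case False
    have "x i + a * y i \<noteq> 0 \<longleftrightarrow> a \<noteq> - x i / y i" for a
      using False by (auto simp: field_simps eq_neg_iff_add_eq_0)
    then have "{a. x i + a * y i \<noteq> 0} = UNIV - {- x i / y i}"
      by auto
    then have "card {a. x i + a * y i \<noteq> 0} = CARD('a) - 1" by (simp add: card_Diff_singleton)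
    then show ?thesis using False q_ge_2[where 'a = 'a] by (simp add: sum_of_bool_eq)
  qed (use i in simp)
  have "(\<Sum>a\<in>UNIV. hamming_weight (x + vscale a y)) + hamming_weight y
      = (\<Sum>a\<in>UNIV. \<Sum>i\<in>?U. of_bool (x i + a * y i \<noteq> 0)) + (\<Sum>i\<in>?U. of_bool (y i \<noteq> 0))"
  proof -
    have "hamming_weight (x + vscale a y) = (\<Sum>i\<in>?U. of_bool (x i + a * y i \<noteq> 0))" for a
      using wt[of "x + vscale a y"] by (fastforce simp: vscale_apply)
    moreover have "hamming_weight y = (\<Sum>i\<in>?U. of_bool (y i \<noteq> 0))"
      using wt[of y] by simp
    ultimately show ?thesis by simp
  qed
  also have "\<dots> = (\<Sum>i\<in>?U. (\<Sum>a\<in>UNIV. of_bool (x i + a * y i \<noteq> 0)) + of_bool (y i \<noteq> 0))"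
    by (subst sum.swap) (simp add: sum.distrib)
  also have "\<dots> = (\<Sum>i\<in>?U. CARD('a))"
    by (rule sum.cong) (use pt in auto)
  finally show ?thesis by simp
qed

text \<open>Double counting of nonzero entries: at each coordinate of the support the words outside
  \<open>shorten C i\<close> contribute.\<close>

lemma sum_weight_code:
  fixes C :: "(nat \<Rightarrow> 'a::{field,finite}) set"
  assumes C: "fvec.subspace C" "card C = CARD('a) ^ Suc k" and fin: "finite (code_supp C)"
  shows "(\<Sum>c\<in>C. hamming_weight c) = card (code_supp C) * (CARD('a) ^ k * (CARD('a) - 1))"
proof -
  have finC: "finite C" using C(2) card_gt_0_iff[of C] by simp
  have "(\<Sum>c\<in>C. hamming_weight c) = (\<Sum>c\<in>C. \<Sum>i\<in>code_supp C. of_bool (c i \<noteq> 0))"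
  proof (rule sum.cong)
    fix c assume "c \<in> C"
    then have "{i. c i \<noteq> 0} = code_supp C \<inter> {i. c i \<noteq> 0}" by (auto simp: code_supp_def)
    then have "hamming_weight c = card (code_supp C \<inter> {i. c i \<noteq> 0})" by (simp add: hamming_weight_def)
    then show "hamming_weight c = (\<Sum>i\<in>code_supp C. of_bool (c i \<noteq> 0))"
      using fin by (simp add: sum_of_bool_eq)
  qed simp
  also have "\<dots> = (\<Sum>i\<in>code_supp C. \<Sum>c\<in>C. of_bool (c i \<noteq> 0))"
    by (rule sum.swap)
  also have "\<dots> = (\<Sum>i\<in>code_supp C. CARD('a) ^ k * (CARD('a) - 1))"
  proof (rule sum.cong)
    fix i assume i: "i \<in> code_supp C"
    have "(\<Sum>c\<in>C. of_bool (c i \<noteq> 0)) = card (C - shorten C i)"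
    proof -
      have "C - shorten C i = C \<inter> {c. c i \<noteq> 0}" by (auto simp: shorten_def)
      then show ?thesis using finC by (simp add: sum_of_bool_eq)
    qed
    also have "\<dots> = card C - card (shorten C i)"
      using finC shorten_subset by (intro card_Diff_subset) (auto intro: finite_subset)
    also have "\<dots> = CARD('a) ^ k * (CARD('a) - 1)"
      using card_shorten_pow[OF C i] C(2) by (simp add: algebra_simps)
    finally show "(\<Sum>c\<in>C. of_bool (c i \<noteq> 0)) = CARD('a) ^ k * (CARD('a) - 1)" .
  qed simp
  finally show ?thesis by simp
qed

subsection \<open>The Griesmer bound and coordinates of maximal multiplicity\<close>

text \<open>Turns a rounded term of the Griesmer sum into an inequality of naturals, the form that
  counting yields.\<close>

lemma nat_ceiling_divide_le_iff:
  assumes "q > 0"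
  shows "nat \<lceil>real d / real q ^ i\<rceil> \<le> m \<longleftrightarrow> d \<le> m * q ^ i"
proof -
  have "nat \<lceil>real d / real q ^ i\<rceil> \<le> m \<longleftrightarrow> real d / real q ^ i \<le> real m"
    by (simp add: nat_le_iff ceiling_le_iff)
  also have "\<dots> \<longleftrightarrow> real d \<le> real (m * q ^ i)"
    using assms by (simp add: divide_le_eq)
  finally show ?thesis by (simp only: of_nat_le_iff)
qed

lemma griesmer_length_0 [simp]: "griesmer_length q 0 d = 0"
  by (simp add: griesmer_length_def)

lemma griesmer_length_Suc:
  "griesmer_length q (Suc k) d = griesmer_length q k d + nat \<lceil>real d / real q ^ k\<rceil>"
  by (simp add: griesmer_length_def)

section \<open>Proportional coordinates and the Griesmer bound\<close>

text \<open>In projective terms: the coordinates in \<open>X\<close> are copies of one point, and \<open>z\<close> does not vanish there.\<close>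

definition aligned :: "(nat \<Rightarrow> 'a::field) set \<Rightarrow> (nat \<Rightarrow> 'a) \<Rightarrow> nat set \<Rightarrow> bool" where
  "aligned C z X \<longleftrightarrow> z \<in> C \<and> (\<forall>i\<in>X. z i \<noteq> 0) \<and> (\<forall>x\<in>C. \<forall>i\<in>X. \<forall>j\<in>X. x i * z j = x j * z i)"

text \<open>Adjoin words \<open>b\<close> of \<open>C\<close> to \<open>D\<close> one at a time. The
  ratio \<open>b j / z j\<close> takes at most \<open>CARD('a)\<close> values on \<open>X\<close>;
  keeping only a frequent one loses at most this factor, which the growth of \<open>D\<close> makes
  up for, so \<open>card X * card D\<close> never drops.\<close>

lemma aligned_refine:
  fixes C :: "(nat \<Rightarrow> 'a::{field,finite}) set"
  assumes C: "fvec.subspace C" "finite C" and D: "fvec.subspace D" "D \<subseteq> C"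
    and X: "finite X" "aligned D z X"
  shows "\<exists>Y\<subseteq>X. aligned C z Y \<and> card X * card D \<le> card C * card Y"
  using D X
proof (induction "card C - card D" arbitrary: D X rule: less_induct)
  case less
  show ?case
  proof (cases "D = C")
    case True
    then show ?thesis using less.prems by (intro exI[of _ X]) auto
  next
    case False
    then obtain b where b: "b \<in> C" "b \<notin> D" using less.prems by auto
    have finD: "finite D" using less.prems(2) C(2) finite_subset by blast
    define D' where "D' = fvec.span (insert b D)"
    have D': "fvec.subspace D'" "D' \<subseteq> C" "D \<subseteq> D'" "card D' = CARD('a) * card D"
      using card_span_insert[OF less.prems(1) finD b(2)] b(1) less.prems(2) C(1)
        fvec.span_superset[of "insert b D"]
      by (auto simp: D'_def intro: fvec.span_minimal[THEN subsetD, rotated])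
    have "card D > 0" using finD fvec.subspace_0[OF less.prems(1)] by (auto simp: card_gt_0_iff)
    then have "card D < card D'" using D'(4) q_ge_2[where 'a = 'a] by simp
    moreover have "card D' \<le> card C" using D'(2) C(2) by (rule card_mono[rotated])
    ultimately have decr: "card C - card D' < card C - card D" by simp
    have al: "z \<in> D" "\<And>i. i \<in> X \<Longrightarrow> z i \<noteq> 0"
      "\<And>x i j. x \<in> D \<Longrightarrow> i \<in> X \<Longrightarrow> j \<in> X \<Longrightarrow> x i * z j = x j * z i"
      using less.prems(4) by (auto simp: aligned_def)
    obtain v where v: "card ((\<lambda>j. b j / z j) -` {v} \<inter> X) * CARD('a) \<ge> card X"
      using pigeonhole_card[of "\<lambda>j. b j / z j" X UNIV] less.prems(3) by auto
    define X' where "X' = (\<lambda>j. b j / z j) -` {v} \<inter> X"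
    \<comment> \<open>On \<open>X'\<close> the new word is a multiple of \<open>z\<close>, so
      alignment extends to the larger span.\<close>
    have bX': "b j = v * z j" if "j \<in> X'" for j
      using that al(2)[of j] by (auto simp: X'_def)
    have "aligned D' z X'"
      unfolding aligned_def
    proof (intro conjI ballI)
      fix x i j assume x: "x \<in> D'" and i: "i \<in> X'" and j: "j \<in> X'"
      from x obtain a where a: "x - vscale a b \<in> D"
        using less.prems(1) by (auto simp: D'_def fvec.span_insert fvec.span_eq_iff[THEN iffD2])
      have "(x - vscale a b) i * z j = (x - vscale a b) j * z i"
        using al(3)[OF a] i j by (auto simp: X'_def)
      then show "x i * z j = x j * z i"
        using bX'[OF i] bX'[OF j] by (simp add: vscale_apply algebra_simps)
    qed (use al D'(3) in \<open>auto simp: X'_def\<close>)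
    then obtain Y where Y: "Y \<subseteq> X'" "aligned C z Y" "card X' * card D' \<le> card C * card Y"
      using less.hyps[OF decr D'(1,2), of X'] less.prems(3) by (auto simp: X'_def)
    have "card X * card D \<le> card X' * card D'"
      using v mult_le_mono1[OF v, of "card D"] by (simp add: D'(4) X'_def mult_ac)
    then show ?thesis using Y by (intro exI[of _ Y]) (auto simp: X'_def)
  qed
qed

text \<open>Subtract from \<open>x\<close> the multiple of \<open>z\<close> that cancels it at
  \<open>j\<close>: the result lies in \<open>shorten D j\<close> and so vanishes on the set. The
  set thus consists of the copies of the point \<open>j\<close>.\<close>

lemma aligned_class:
  assumes D: "fvec.subspace D" and z: "z \<in> D" "z j \<noteq> 0"
  shows "aligned D z (code_supp D - code_supp (shorten D j))"
proof -
  let ?X = "code_supp D - code_supp (shorten D j)"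
  have *: "x i * z j = x j * z i" if "x \<in> D" "i \<in> ?X" for x i
  proof -
    let ?y = "x - vscale (x j / z j) z"
    have "?y \<in> D" using D z(1) that(1) by (simp add: fvec.subspace_diff fvec.subspace_scale)
    then have "?y \<in> shorten D j" using z(2) by (simp add: shorten_def vscale_apply)
    then have "?y i = 0" using that(2) by (auto simp: code_supp_def)
    then show ?thesis using z(2) by (simp add: vscale_apply field_simps)
  qed
  have nz: "z i \<noteq> 0" if i: "i \<in> ?X" for i
  proof -
    obtain x where x: "x \<in> D" "x i \<noteq> 0" using i by (auto simp: code_supp_def)
    then show ?thesis using *[OF x(1) i] z(2) by auto
  qed
  show ?thesis
    unfolding aligned_def
  proof (intro conjI ballI)
    fix x i k assume x: "x \<in> D" and i: "i \<in> ?X" and k: "k \<in> ?X"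
    have "(x i * z k) * z j = (x i * z j) * z k" by (simp add: mult_ac)
    also have "\<dots> = (x k * z j) * z i" using *[OF x i] *[OF x k] by (simp add: mult_ac)
    finally have "(x i * z k) * z j = (x k * z i) * z j" by (simp add: mult_ac)
    then show "x i * z k = x k * z i" using z(2) by simp
  qed (use z nz in auto)
qed

text \<open>By alignment a word that vanishes at \<open>i\<close> vanishes on all of
  \<open>Y\<close>, so shortening loses \<open>Y\<close> as a whole.\<close>

lemma card_supp_shorten_aligned:
  assumes "aligned C z Y" "i \<in> Y" "finite (code_supp C)"
  shows "i \<in> code_supp C" "card (code_supp (shorten C i)) + card Y \<le> card (code_supp C)"
proof -
  have Y: "Y \<subseteq> code_supp C"
    using assms(1) by (auto simp: aligned_def code_supp_def)
  then show "i \<in> code_supp C" using assms(2) by auto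
  have disj: "code_supp (shorten C i) \<inter> Y = {}"
  proof (rule ccontr)
    assume "code_supp (shorten C i) \<inter> Y \<noteq> {}"
    then obtain j x where "j \<in> Y" "x \<in> C" "x i = 0" "x j \<noteq> 0"
      by (auto simp: code_supp_def shorten_def)
    moreover from this have "x i * z j = x j * z i" "z i \<noteq> 0"
      using assms(1,2) by (auto simp: aligned_def)
    ultimately show False by auto
  qed
  have "code_supp (shorten C i) \<union> Y \<subseteq> code_supp C"
    using Y code_supp_mono[OF shorten_subset] by auto
  then have "card (code_supp (shorten C i) \<union> Y) \<le> card (code_supp C)"
    using assms(3) by (simp add: card_mono)
  then show "card (code_supp (shorten C i)) + card Y \<le> card (code_supp C)"
    using disj Y assms(3) code_supp_mono[OF shorten_subset, of C i]
    by (subst (asm) card_Un_disjoint) (auto intro: finite_subset)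
qed

lemma ex_nonzero_word:
  fixes C :: "(nat \<Rightarrow> 'a::{field,finite}) set"
  assumes "card C = CARD('a) ^ Suc k"
  obtains z where "z \<in> C" "z \<noteq> 0"
proof -
  have "card C > 1"
    using assms q_ge_2[where 'a = 'a] one_less_power[of "CARD('a)" "Suc k"] by simp
  then have "\<not> C \<subseteq> {0}"
    using card_mono[of "{0}" C] by auto
  then show ?thesis using that by auto
qed

lemma aligned_line:
  fixes z :: "nat \<Rightarrow> 'a::{field,finite}"
  assumes "z \<noteq> 0"
  shows "aligned (fvec.span {z}) z {i. z i \<noteq> 0}" "card (fvec.span {z}) = CARD('a)"
proof -
  have "card (fvec.span (insert z {0})) = CARD('a) * card {0 :: nat \<Rightarrow> 'a}"
    using card_span_insert[of "{0}" z] assms by (simp add: fvec.subspace_single_0)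
  moreover have "fvec.span (insert z {0}) = fvec.span {z}"
    using fvec.span_insert_0[of "{z}"] by (simp add: insert_commute)
  ultimately show "card (fvec.span {z}) = CARD('a)" by simp
  show "aligned (fvec.span {z}) z {i. z i \<noteq> 0}"
    using fvec.span_base[of z "{z}"] by (auto simp: aligned_def fvec.span_singleton vscale_apply)
qed

lemma ex_aligned_of_weight:
  fixes C :: "(nat \<Rightarrow> 'a::{field,finite}) set"
  assumes C: "fvec.subspace C" "finite C" and z: "z \<in> C" "z \<noteq> 0" "finite {i. z i \<noteq> 0}"
  obtains Y where "aligned C z Y" "hamming_weight z * CARD('a) \<le> card C * card Y"
proof -
  have "fvec.span {z} \<subseteq> C" using C(1) z(1) by (intro fvec.span_minimal) auto
  then show ?thesis
    using aligned_refine[OF C fvec.subspace_span _ z(3) aligned_line(1)[OF z(2)]] that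
    by (auto simp: aligned_line(2)[OF z(2)] hamming_weight_def)
qed

text \<open>In dimension \<open>Suc k\<close>, a word of weight at least \<open>d\<close> refines to
  an aligned set of at least \<open>d / q ^ k\<close> coordinates. Shortening at one of them removes
  them all and keeps the weight bound; this loss pays for the last Griesmer term.\<close>

lemma griesmer_bound:
  fixes C :: "(nat \<Rightarrow> 'a::{field,finite}) set"
  assumes "fvec.subspace C" "card C = CARD('a) ^ k" "finite (code_supp C)"
    and "\<forall>c\<in>C - {0}. d \<le> hamming_weight c"
  shows "griesmer_length CARD('a) k d \<le> card (code_supp C)"
  using assms
proof (induction k arbitrary: C)
  case (Suc k)
  note C = Suc.prems
  have finC: "finite C" using C(2) card_gt_0_iff[of C] by simp
  obtain z where z: "z \<in> C" "z \<noteq> 0" using ex_nonzero_word[OF C(2)] .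
  obtain Y where Y: "aligned C z Y" "hamming_weight z * CARD('a) \<le> card C * card Y"
    using ex_aligned_of_weight[OF C(1) finC z finite_word_supp[OF C(3) z(1)]] .
  have "CARD('a) * hamming_weight z \<le> CARD('a) * (card Y * CARD('a) ^ k)"
    using Y(2) by (simp add: C(2) mult_ac)
  moreover have "d \<le> hamming_weight z" using C(4) z by blast
  ultimately have d: "d \<le> card Y * CARD('a) ^ k" by simp
  show ?case
  proof (cases "Y = {}")
    \<comment> \<open>There is no coordinate to shorten at; this forces \<open>d = 0\<close>, where
      the bound is 0.\<close>
    case True
    then have "d = 0" using d by simp
    then show ?thesis by (simp add: griesmer_length_def)
  next
    case False
    then obtain i where i: "i \<in> Y" by auto
    note supp = card_supp_shorten_aligned[OF Y(1) i C(3)]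
    have "griesmer_length CARD('a) k d \<le> card (code_supp (shorten C i))"
      using C(3,4) shorten_subset[of C i] code_supp_mono[OF shorten_subset, of C i]
      by (intro Suc.IH subspace_shorten C(1) card_shorten_pow[OF C(1,2) supp(1)])
        (auto intro: finite_subset)
    moreover have "nat \<lceil>real d / real CARD('a) ^ k\<rceil> \<le> card Y"
      using d by (subst nat_ceiling_divide_le_iff) auto
    ultimately show ?thesis using supp(2) unfolding griesmer_length_Suc by linarith
  qed
qed simp

text \<open>Griesmer codes with the support in place of the length, so that shortened and residual
  codes need no renumbering of coordinates. The weight \<open>d\<close> is only a lower bound here;
  \<open>ex_min_weight_word\<close> shows that it is attained in positive dimension.\<close>

definition meets_griesmer :: "nat \<Rightarrow> nat \<Rightarrow> (nat \<Rightarrow> 'a::{field,finite}) set \<Rightarrow> bool" where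
  "meets_griesmer k d C \<longleftrightarrow>
     fvec.subspace C \<and> card C = CARD('a) ^ k \<and> finite (code_supp C) \<and>
     (\<forall>c\<in>C - {0}. d \<le> hamming_weight c) \<and>
     card (code_supp C) = griesmer_length CARD('a) k d"

lemma meets_griesmerD:
  fixes C :: "(nat \<Rightarrow> 'a::{field,finite}) set"
  assumes "meets_griesmer k d C"
  shows "fvec.subspace C" "card C = CARD('a) ^ k" "finite (code_supp C)"
    "\<And>c. c \<in> C \<Longrightarrow> c \<noteq> 0 \<Longrightarrow> d \<le> hamming_weight c"
    "card (code_supp C) = griesmer_length CARD('a) k d" "finite C"
    "\<And>c. c \<in> C \<Longrightarrow> finite {i. c i \<noteq> 0}"
proof -
  show *: "fvec.subspace C" "card C = CARD('a) ^ k" "finite (code_supp C)"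
    "card (code_supp C) = griesmer_length CARD('a) k d"
    "\<And>c. c \<in> C \<Longrightarrow> c \<noteq> 0 \<Longrightarrow> d \<le> hamming_weight c"
    using assms by (auto simp: meets_griesmer_def)
  then show "finite C" using card_gt_0_iff[of C] by simp
  show "\<And>c. c \<in> C \<Longrightarrow> finite {i. c i \<noteq> 0}"
    using finite_word_supp[OF *(3)] by auto
qed

text \<open>Shortening at \<open>i\<close> loses all copies of the point \<open>i\<close>; the length that is left meets the Griesmer
  bound iff there are \<open>\<lceil>d / q ^ (k - 1)\<rceil>\<close> copies, the maximum possible.\<close>

definition max_coords :: "nat \<Rightarrow> nat \<Rightarrow> (nat \<Rightarrow> 'a::{field,finite}) set \<Rightarrow> nat set" where
  "max_coords k d C = {i \<in> code_supp C. meets_griesmer (k - 1) d (shorten C i)}"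

text \<open>The size condition asks for \<open>d / q ^ (m - 1)\<close> coordinates if
  \<open>D\<close> has dimension \<open>m\<close>. Refined to \<open>C\<close>, they leave at least
  \<open>d / q ^ k\<close> copies of one point. Shortening there leaves at most the Griesmer length
  for \<open>k\<close>, and \<open>griesmer_bound\<close> forces equality.\<close>

lemma max_coords_aligned:
  fixes C :: "(nat \<Rightarrow> 'a::{field,finite}) set"
  assumes C: "meets_griesmer (Suc k) d C" and D: "fvec.subspace D" "D \<subseteq> C"
    and X: "finite X" "aligned D z X" "d * CARD('a) \<le> card X * card D" and d: "d \<ge> 1"
  shows "X \<inter> max_coords (Suc k) d C \<noteq> {}"
proof -
  note C' = meets_griesmerD[OF C]
  obtain Y where Y: "Y \<subseteq> X" "aligned C z Y" "card X * card D \<le> card C * card Y"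
    using aligned_refine[OF C'(1,6) D X(1,2)] by auto
  have "CARD('a) * d \<le> CARD('a) * (card Y * CARD('a) ^ k)"
    using le_trans[OF X(3) Y(3)] by (simp add: C'(2) mult_ac)
  then have dY: "d \<le> card Y * CARD('a) ^ k" by simp
  then have "Y \<noteq> {}" using d by auto
  then obtain i where i: "i \<in> Y" by auto
  note supp = card_supp_shorten_aligned[OF Y(2) i C'(3)]
  let ?D = "shorten C i"
  have D': "fvec.subspace ?D" "card ?D = CARD('a) ^ k" "finite (code_supp ?D)"
    "\<forall>c\<in>?D - {0}. d \<le> hamming_weight c"
    using subspace_shorten[OF C'(1)] card_shorten_pow[OF C'(1,2) supp(1)] C'(3,4)
      code_supp_mono[OF shorten_subset, of C i] shorten_subset[of C i]
    by (auto intro: finite_subset)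
  have "nat \<lceil>real d / real CARD('a) ^ k\<rceil> \<le> card Y"
    using dY by (subst nat_ceiling_divide_le_iff) auto
  then have "card (code_supp ?D) \<le> griesmer_length CARD('a) k d"
    using supp(2) C'(5) unfolding griesmer_length_Suc by linarith
  then have "meets_griesmer k d ?D"
    using griesmer_bound[OF D'] D' by (simp add: meets_griesmer_def)
  then show ?thesis using i Y(1) supp(1) by (auto simp: max_coords_def)
qed

lemma max_coords_nonempty:
  fixes C :: "(nat \<Rightarrow> 'a::{field,finite}) set"
  assumes C: "meets_griesmer (Suc k) d C" and d: "d \<ge> 1"
  shows "max_coords (Suc k) d C \<noteq> {}"
proof -
  note C' = meets_griesmerD[OF C]
  obtain z where z: "z \<in> C" "z \<noteq> 0" using ex_nonzero_word[OF C'(2)] .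
  have "fvec.span {z} \<subseteq> C" using C'(1) z(1) by (intro fvec.span_minimal) auto
  then show ?thesis
    using max_coords_aligned[OF C fvec.subspace_span _ C'(7)[OF z(1)] aligned_line(1)[OF z(2)] _ d]
      C'(4)[OF z] by (auto simp: aligned_line(2)[OF z(2)] hamming_weight_def)
qed

lemma meets_griesmer_subcode:
  assumes "meets_griesmer k d C" "m \<le> k" "d \<ge> 1"
  shows "\<exists>D\<subseteq>C. meets_griesmer m d D"
  using assms
proof (induction k arbitrary: C)
  case (Suc k)
  show ?case
  proof (cases "m = Suc k")
    case False
    obtain i where "i \<in> max_coords (Suc k) d C"
      using max_coords_nonempty[OF Suc.prems(1,3)] by auto
    then have "meets_griesmer k d (shorten C i)" by (simp add: max_coords_def)
    then show ?thesis
      using Suc.IH[of "shorten C i"] Suc.prems False shorten_subset[of C i] by auto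
  qed (use Suc.prems in auto)
qed auto

text \<open>Induction by shortening at a maximal coordinate \<open>i\<close>. A maximal coordinate
  \<open>j\<close> of the shortened code is traded for one of \<open>C\<close>: among the copies of
  its point there is some \<open>l\<close> maximal in \<open>C\<close>, and a word of the shortened
  code that vanishes at \<open>l\<close> vanishes at \<open>j\<close>.\<close>

lemma max_coords_spanning:
  fixes C :: "(nat \<Rightarrow> 'a::{field,finite}) set"
  assumes "meets_griesmer k d C" "d \<ge> 1" "x \<in> C" "\<forall>i\<in>max_coords k d C. x i = 0"
  shows "x = 0"
  using assms
proof (induction k arbitrary: C)
  case 0
  then have "card C = 1" by (simp add: meets_griesmer_def)
  moreover have "0 \<in> C" using meets_griesmerD(1)[OF 0(1)] by (rule fvec.subspace_0)
  ultimately show ?case using 0(3) by (auto simp: card_1_singleton_iff)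
next
  case (Suc k)
  note C = meets_griesmerD[OF Suc.prems(1)]
  obtain i where i: "i \<in> max_coords (Suc k) d C"
    using max_coords_nonempty[OF Suc.prems(1,2)] by auto
  let ?D = "shorten C i"
  have D: "meets_griesmer k d ?D" using i by (simp add: max_coords_def)
  note D' = meets_griesmerD[OF D]
  have x: "x \<in> ?D" using Suc.prems(3,4) i by (simp add: shorten_def)
  have "x j = 0" if j: "j \<in> max_coords k d ?D" for j
  proof (cases k)
    \<comment> \<open>\<open>max_coords\<close> refers to the truncated \<open>k - 1\<close>, so
      this dimension is treated apart; only the zero word is left.\<close>
    case 0
    then have "card ?D = 1" using D'(2) by simp
    moreover have "0 \<in> ?D" using D'(1) by (rule fvec.subspace_0)
    ultimately show ?thesis using x by (auto simp: card_1_singleton_iff)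
  next
    case k: (Suc k')
    let ?E = "shorten ?D j"
    have E: "meets_griesmer k' d ?E" and jD: "j \<in> code_supp ?D"
      using j by (auto simp: max_coords_def k)
    let ?X = "code_supp ?D - code_supp ?E"
    from jD obtain z where z: "z \<in> ?D" "z j \<noteq> 0" by (auto simp: code_supp_def)
    have X: "aligned ?D z ?X" by (rule aligned_class[OF D'(1) z])
    have "card ?X = card (code_supp ?D) - card (code_supp ?E)"
      using D'(3) code_supp_mono[OF shorten_subset, of ?D j]
      by (intro card_Diff_subset) (auto intro: finite_subset)
    also have "\<dots> = nat \<lceil>real d / real CARD('a) ^ k'\<rceil>"
      using D'(5) meets_griesmerD(5)[OF E] by (simp add: k griesmer_length_Suc)
    \<comment> \<open>Removing the copies of \<open>j\<close> costs exactly the last Griesmer term,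
      so \<open>?X\<close> is large enough to be refined in \<open>C\<close>.\<close>
    finally have "d \<le> card ?X * CARD('a) ^ k'"
      using nat_ceiling_divide_le_iff[of "CARD('a)" d k' "card ?X"] by simp
    then have "d * CARD('a) \<le> card ?X * card ?D"
      using mult_le_mono1[of d "card ?X * CARD('a) ^ k'" "CARD('a)"] by (simp add: D'(2) k mult_ac)
    then obtain l where l: "l \<in> ?X" "l \<in> max_coords (Suc k) d C"
      using max_coords_aligned[OF Suc.prems(1) D'(1) shorten_subset _ X _ Suc.prems(2)] D'(3) by auto
    have jX: "j \<in> ?X" using jD by (auto simp: code_supp_def shorten_def)
    have "x l * z j = x j * z l" "z l \<noteq> 0"
      using X x l(1) jX by (auto simp: aligned_def)
    moreover have "x l = 0" using l(2) Suc.prems(4) by auto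
    ultimately show ?thesis by auto
  qed
  then show ?case using Suc.IH[OF D Suc.prems(2) x] by auto
qed

subsection \<open>Minimum weight words and residual codes\<close>

text \<open>Splits off the first term instead of the last, as the passage to a residual code
  does.\<close>

lemma griesmer_length_Suc_dvd:
  assumes "q > 0" "q dvd d"
  shows "griesmer_length q (Suc k) d = d + griesmer_length q k (d div q)"
proof -
  have "real d / real q ^ Suc i = real (d div q) / real q ^ i" for i
    using assms by (simp add: real_of_nat_div)
  then show ?thesis
    unfolding griesmer_length_def sum.lessThan_Suc_shift by simp
qed

lemma griesmer_length_less_Suc:
  assumes "q > 0"
  shows "griesmer_length q (Suc k) d < griesmer_length q (Suc k) (Suc d)"
proof -
  have "(\<Sum>i<k. nat \<lceil>real d / real q ^ Suc i\<rceil>) \<le> (\<Sum>i<k. nat \<lceil>real (Suc d) / real q ^ Suc i\<rceil>)"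
    by (intro sum_mono nat_mono ceiling_mono divide_right_mono) auto
  then show ?thesis
    unfolding griesmer_length_def sum.lessThan_Suc_shift by (simp del: of_nat_Suc)
qed

text \<open>Nothing is rounded, so the sum is geometric, with value
  \<open>d * (q ^ Suc k - 1) / (q ^ k * (q - 1))\<close>; the identity clears denominators.\<close>

lemma griesmer_length_pow_dvd:
  assumes "q > 0" "q ^ k dvd d"
  shows "griesmer_length q (Suc k) d * (q ^ k * (q - 1)) + d = d * q ^ Suc k"
  using assms(2)
proof (induction k arbitrary: d)
  case 0
  then show ?case using assms(1) by (cases q) (simp_all add: griesmer_length_Suc algebra_simps)
next
  case (Suc k)
  then obtain m where m: "d = q * m" "q ^ k dvd m" using assms(1) by auto
  have "griesmer_length q (Suc (Suc k)) d = d + griesmer_length q (Suc k) m"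
    using assms(1) griesmer_length_Suc_dvd[of q d "Suc k"] by (simp add: m(1))
  moreover have "(d + l) * (q ^ Suc k * t) + d = d * (q ^ Suc k * t) + q * (l * (q ^ k * t) + m)" for l t
    by (simp add: algebra_simps m(1))
  ultimately have "griesmer_length q (Suc (Suc k)) d * (q ^ Suc k * (q - 1)) + d
      = d * (q ^ Suc k * (q - 1)) + q * (griesmer_length q (Suc k) m * (q ^ k * (q - 1)) + m)"
    by simp
  also have "\<dots> = d * (q ^ Suc k * (q - 1)) + q * (m * q ^ Suc k)"
    using Suc.IH[OF m(2)] by simp
  also have "\<dots> = d * q ^ Suc (Suc k)"
    using assms(1) by (cases q) (simp_all add: m(1) algebra_simps)
  finally show ?case .
qed

text \<open>Otherwise \<open>griesmer_bound\<close> would apply to \<open>Suc d\<close> and ask for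
  a longer code.\<close>

lemma ex_min_weight_word:
  fixes C :: "(nat \<Rightarrow> 'a::{field,finite}) set"
  assumes C: "meets_griesmer (Suc k) d C"
  shows "\<exists>c\<in>C - {0}. hamming_weight c = d"
proof (rule ccontr)
  note C' = meets_griesmerD[OF C]
  assume "\<not> ?thesis"
  then have "\<forall>c\<in>C - {0}. Suc d \<le> hamming_weight c"
    using C'(4) by (metis DiffD1 DiffD2 Suc_leI insertI1 le_neq_implies_less)
  from griesmer_bound[OF C'(1-3) this] C'(5) griesmer_length_less_Suc[of "CARD('a)" k d]
  show False by simp
qed

text \<open>By \<open>sum_weight_code\<close> the nonzero words have average weight exactly
  \<open>d\<close>, and \<open>d\<close> is also a lower bound for each.\<close>

lemma constant_weight:
  fixes C :: "(nat \<Rightarrow> 'a::{field,finite}) set"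
  assumes C: "meets_griesmer (Suc k) d C" and dvd: "CARD('a) ^ k dvd d" and c: "c \<in> C" "c \<noteq> 0"
  shows "hamming_weight c = d"
proof -
  note C' = meets_griesmerD[OF C]
  have 0: "0 \<in> C" using C'(1) by (rule fvec.subspace_0)
  have "(\<Sum>c\<in>C. hamming_weight c) = (\<Sum>c\<in>C - {0}. hamming_weight c)"
    using C'(6) 0 by (intro sum.mono_neutral_right) (auto simp: hamming_weight_def)
  then have "(\<Sum>c\<in>C - {0}. hamming_weight c) + d = d * CARD('a) ^ Suc k"
    using sum_weight_code[OF C'(1-3)] griesmer_length_pow_dvd[OF _ dvd] by (simp add: C'(5))
  moreover have "(\<Sum>c\<in>C - {0}. d) + d = d * CARD('a) ^ Suc k"
    using C'(2,6) 0 by (simp add: card_Diff_singleton) (simp add: algebra_simps)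
  ultimately have "(\<Sum>c\<in>C - {0}. d) = (\<Sum>c\<in>C - {0}. hamming_weight c)" by simp
  then show ?thesis
    using sum_mono_inv[of "\<lambda>_. d" "C - {0}" hamming_weight c] C'(4,6) c by auto
qed

section \<open>Residual codes, with the coordinates in the support zeroed instead of deleted\<close>

definition off_supp :: "(nat \<Rightarrow> 'a::zero) \<Rightarrow> (nat \<Rightarrow> 'a) \<Rightarrow> nat \<Rightarrow> 'a" where
  "off_supp g x = (\<lambda>i. if g i = 0 then x i else 0)"

lemma card_union_supp:
  assumes "finite {i. x i \<noteq> 0}" "finite {i. g i \<noteq> 0}"
  shows "card {i. x i \<noteq> 0 \<or> g i \<noteq> 0} = hamming_weight g + hamming_weight (off_supp g x)"
proof -
  have "{i. x i \<noteq> 0 \<or> g i \<noteq> 0} = {i. g i \<noteq> 0} \<union> {i. off_supp g x i \<noteq> 0}"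
    by (auto simp: off_supp_def)
  moreover have "finite {i. off_supp g x i \<noteq> 0}"
    using assms(1) by (rule finite_subset[rotated]) (auto simp: off_supp_def)
  ultimately show ?thesis
    using assms(2) by (simp add: hamming_weight_def) (subst card_Un_disjoint, auto simp: off_supp_def)
qed

text \<open>Summing the bound \<open>d\<close> over the words \<open>x + vscale a g\<close> and
  comparing with \<open>sum_weight_line\<close> bounds the residual weights. As this bound is
  positive, the kernel of \<open>off_supp g\<close> is the line of \<open>g\<close>, which gives the
  dimension. The length drops by \<open>d\<close>, the first Griesmer term.\<close>

lemma meets_griesmer_residual:
  fixes C :: "(nat \<Rightarrow> 'a::{field,finite}) set"
  assumes C: "meets_griesmer (Suc k) d C" and d: "d \<ge> 1" "CARD('a) dvd d"
    and g: "g \<in> C" "hamming_weight g = d"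
  shows "meets_griesmer k (d div CARD('a)) (off_supp g ` C)"
proof -
  note C' = meets_griesmerD[OF C]
  let ?R = "off_supp g ` C"
  have add: "off_supp g (x + y) = off_supp g x + off_supp g y"
    and diff: "off_supp g (x - y) = off_supp g x - off_supp g y"
    and scale: "off_supp g (vscale a x) = vscale a (off_supp g x)" for x y a
    by (auto simp: off_supp_def fun_eq_iff vscale_apply)
  have g0: "g \<noteq> 0" using g(2) d(1) by (auto simp: hamming_weight_def)
  have weight: "d div CARD('a) \<le> hamming_weight (off_supp g x)"
    if x: "x \<in> C" "x \<notin> fvec.span {g}" for x
  proof -
    have "d \<le> hamming_weight (x + vscale a g)" for a
    proof (rule C'(4))
      show "x + vscale a g \<in> C"
        using x(1) g(1) C'(1) by (simp add: fvec.subspace_add fvec.subspace_scale)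
      have "x = vscale (- a) g" if "x + vscale a g = 0"
        using that by (simp only: fvec.scale_minus_left eq_neg_iff_add_eq_0)
      then show "x + vscale a g \<noteq> 0"
        using x(2) by (metis fvec.span_singleton rangeI)
    qed
    then have "(\<Sum>a\<in>(UNIV :: 'a set). d) \<le> (\<Sum>a\<in>UNIV. hamming_weight (x + vscale a g))"
      by (intro sum_mono) simp
    then have "d \<le> CARD('a) * hamming_weight (off_supp g x)"
      using sum_weight_line[OF C'(7)[OF x(1)] C'(7)[OF g(1)]]
        card_union_supp[OF C'(7)[OF x(1)] C'(7)[OF g(1)]]
      by (simp add: g(2) algebra_simps)
    then have "d div CARD('a) \<le> CARD('a) * hamming_weight (off_supp g x) div CARD('a)"
      by (rule div_le_mono)
    then show ?thesis by simp
  qed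
  have "CARD('a) \<le> d" using d by (simp add: dvd_imp_le)
  then have pos: "d div CARD('a) > 0" by (simp add: div_greater_zero_iff)
  have "fvec.subspace ?R"
    unfolding fvec.subspace_def
  proof (intro conjI ballI allI)
    show "0 \<in> ?R"
      using fvec.subspace_0[OF C'(1)] by (intro image_eqI[of _ _ 0]) (auto simp: off_supp_def fun_eq_iff)
  qed (auto simp: add[symmetric] scale[symmetric]
        intro!: imageI fvec.subspace_add[OF C'(1)] fvec.subspace_scale[OF C'(1)])
  moreover have "card ?R = CARD('a) ^ k"
  proof -
    have "{x \<in> C. off_supp g x = 0} = fvec.span {g}"
    proof (intro equalityI subsetI)
      fix x assume "x \<in> {x \<in> C. off_supp g x = 0}"
      then show "x \<in> fvec.span {g}"
        using weight[of x] pos by (auto simp: hamming_weight_def)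
    next
      fix x assume "x \<in> fvec.span {g}"
      then show "x \<in> {x \<in> C. off_supp g x = 0}"
        using C'(1) g(1)
        by (auto simp: fvec.span_singleton fvec.subspace_scale off_supp_def fun_eq_iff vscale_apply)
    qed
    then show ?thesis
      using card_additive_image[OF C'(1,6), of "off_supp g"] C'(2) diff aligned_line(2)[OF g0]
      by simp
  qed
  moreover have supp: "code_supp ?R = code_supp C - {i. g i \<noteq> 0}"
    by (auto simp: code_supp_def off_supp_def)
  moreover have "finite (code_supp ?R)" using supp C'(3) by simp
  moreover have "card (code_supp ?R) = griesmer_length CARD('a) k (d div CARD('a))"
  proof -
    have "card (code_supp ?R) = card (code_supp C) - card {i. g i \<noteq> 0}"
      unfolding supp using C'(7)[OF g(1)] g(1)
      by (intro card_Diff_subset) (auto simp: code_supp_def)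
    then show ?thesis
      using C'(5) g(2) griesmer_length_Suc_dvd[OF _ d(2)] by (simp add: hamming_weight_def)
  qed
  moreover have "d div CARD('a) \<le> hamming_weight y" if "y \<in> ?R - {0}" for y
  proof -
    from that obtain x where x: "x \<in> C" "y = off_supp g x" "y \<noteq> 0" by auto
    have "x \<notin> fvec.span {g}"
    proof
      assume "x \<in> fvec.span {g}"
      then obtain a where "x = vscale a g" by (auto simp: fvec.span_singleton)
      then have "y i = 0" for i using x(2) by (simp add: off_supp_def vscale_apply)
      then show False using x(3) by (simp add: zero_fun_iff)
    qed
    then show ?thesis using weight x by simp
  qed
  ultimately show ?thesis by (auto simp: meets_griesmer_def)
qed

subsection \<open>A word of a three-dimensional constant weight code taking all ratios\<close>

text \<open>Constant weight makes \<open>D\<close> an \<open>m\<close>-fold projective plane with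
  \<open>d = m * q ^ 2\<close>: each point has exactly \<open>m\<close> coordinates. By
  \<open>max_coords_aligned\<close> one of them is maximal in \<open>C\<close>, and \<open>R\<close>
  picks one for each point. A nonzero word has weight \<open>m * q ^ 2\<close>, hence is nonzero at
  \<open>q ^ 2\<close> points.\<close>

lemma ex_transversal:
  fixes C D :: "(nat \<Rightarrow> 'a::{field,finite}) set"
  assumes C: "meets_griesmer (Suc k) d C" and d: "d \<ge> 1"
    and D: "meets_griesmer (Suc (Suc (Suc 0))) d D" "D \<subseteq> C"
    and dvd: "CARD('a) ^ 2 dvd d"
  shows "\<exists>R\<subseteq>max_coords (Suc k) d C \<inter> code_supp D.
    (\<forall>g\<in>D - {0}. card {i\<in>R. g i \<noteq> 0} = CARD('a) ^ 2) \<and>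
    (\<forall>i\<in>R. \<forall>j\<in>R. i \<noteq> j \<longrightarrow> (\<exists>x\<in>D. x i = 0 \<and> x j \<noteq> 0))"
proof -
  note D' = meets_griesmerD[OF D(1)]
  let ?q = "CARD('a)"
  obtain m where m: "d = m * ?q ^ 2" using dvd by (auto simp: mult.commute)
  have m0: "m > 0" using d m by auto
  \<comment> \<open>For \<open>i\<close> in the support, these are the copies of the point
    \<open>i\<close> of \<open>D\<close>.\<close>
  define cls where "cls i = code_supp D - code_supp (shorten D i)" for i
  have wt: "hamming_weight x = d" if "x \<in> D" "x \<noteq> 0" for x
    using constant_weight[OF D(1) _ that] dvd by (simp add: power2_eq_square)
  \<comment> \<open>Subcodes inherit the constant weight, so their size determines their support.
    Applied to \<open>D\<close> and \<open>shorten D i\<close>, this yields the size of a class as a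
    difference.\<close>
  have total: "card (code_supp E) * (?q ^ l * (?q - 1)) + d = d * ?q ^ Suc l"
    if E: "fvec.subspace E" "card E = ?q ^ Suc l" "E \<subseteq> D" for E l
  proof -
    have finE: "finite E" using E(3) D'(6) finite_subset by blast
    have "(\<Sum>c\<in>E. hamming_weight c) = (\<Sum>c\<in>E - {0}. hamming_weight c)"
      using finE fvec.subspace_0[OF E(1)]
      by (intro sum.mono_neutral_right) (auto simp: hamming_weight_def)
    also have "\<dots> = (\<Sum>c\<in>E - {0}. d)"
      using E(3) wt by (intro sum.cong) auto
    finally have "(\<Sum>c\<in>E. hamming_weight c) + d = d * ?q ^ Suc l"
      using E(2) finE fvec.subspace_0[OF E(1)]
      by (simp add: card_Diff_singleton) (simp add: algebra_simps)
    moreover have "finite (code_supp E)"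
      using code_supp_mono[OF E(3)] D'(3) finite_subset by blast
    ultimately show ?thesis using sum_weight_code[OF E(1,2)] by simp
  qed
  have q1: "?q ^ l * (?q - 1) > 0" for l using q_ge_2[where 'a = 'a] by simp
  obtain t where t: "?q = Suc t" using q_ge_2[where 'a = 'a] by (cases "?q") auto
  have suppD: "card (code_supp D) = m * (?q ^ 2 + ?q + 1)"
  proof -
    have "card (code_supp D) * (?q ^ 2 * (?q - 1)) + d = d * ?q ^ Suc 2"
      using total[OF D'(1) _ subset_refl, of 2] D'(2) by (simp add: eval_nat_numeral)
    also have "\<dots> = (m * (?q ^ 2 + ?q + 1)) * (?q ^ 2 * (?q - 1)) + d"
      unfolding m t by (simp add: algebra_simps eval_nat_numeral)
    finally show ?thesis using q1[of 2] by (metis add_right_cancel mult_right_cancel neq0_conv)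
  qed
  have card_cls: "card (cls i) = m" if i: "i \<in> code_supp D" for i
  proof -
    have "card (shorten D i) = ?q ^ Suc 1"
      using card_shorten_pow[OF D'(1,2) i] by simp
    from total[OF subspace_shorten[OF D'(1)] this shorten_subset]
    have "card (code_supp (shorten D i)) * (?q ^ 1 * (?q - 1)) + d = d * ?q ^ Suc 1" .
    also have "\<dots> = (m * (?q ^ 2 + ?q)) * (?q ^ 1 * (?q - 1)) + d"
      unfolding m t by (simp add: algebra_simps eval_nat_numeral)
    finally have "card (code_supp (shorten D i)) = m * (?q ^ 2 + ?q)"
      using q1[of 1] by (metis add_right_cancel mult_right_cancel neq0_conv)
    then show ?thesis
      unfolding cls_def using suppD D'(3) code_supp_mono[OF shorten_subset, of D i]
      by (subst card_Diff_subset) (auto intro: finite_subset simp: algebra_simps)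
  qed
  have self: "i \<in> cls i" if "i \<in> code_supp D" for i
    using that by (auto simp: cls_def code_supp_def shorten_def)
  have al: "\<exists>z. aligned D z (cls i)" if i: "i \<in> code_supp D" for i
    using aligned_class[OF D'(1)] i by (auto simp: cls_def code_supp_def)
  have shorten_eq: "shorten D j = shorten D i" if i: "i \<in> code_supp D" and j: "j \<in> cls i" for i j
  proof -
    obtain z where z: "aligned D z (cls i)" using al[OF i] by auto
    have "x i * z j = x j * z i" "z i \<noteq> 0" "z j \<noteq> 0" if "x \<in> D" for x
      using z that j self[OF i] by (auto simp: aligned_def)
    then show ?thesis unfolding shorten_def by (metis (no_types, lifting) mult_eq_0_iff)
  qed
  then have cls_eq: "cls j = cls i" if "i \<in> code_supp D" "j \<in> cls i" for i j
    using that by (auto simp: cls_def)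
  have "\<exists>j. j \<in> cls i \<and> j \<in> max_coords (Suc k) d C" if i: "i \<in> code_supp D" for i
  proof -
    obtain z where z: "aligned D z (cls i)" using al[OF i] by auto
    have "finite (cls i)" using D'(3) by (simp add: cls_def)
    then have "cls i \<inter> max_coords (Suc k) d C \<noteq> {}"
      using max_coords_aligned[OF C D'(1) D(2) _ z _ d] card_cls[OF i] D'(2) m
      by (simp add: power2_eq_square mult_ac)
    then show ?thesis by auto
  qed
  then have ex: "i \<in> code_supp D \<Longrightarrow> \<exists>j. j \<in> cls i \<and> j \<in> max_coords (Suc k) d C" for i
    by blast
  \<comment> \<open>Chosen as a function of the class, not of the coordinate, so that
    \<open>R\<close> meets each class only once.\<close>
  define rep where "rep X = (SOME j. j \<in> X \<and> j \<in> max_coords (Suc k) d C)" for X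
  have rep: "rep (cls i) \<in> cls i" "rep (cls i) \<in> max_coords (Suc k) d C"
    if "i \<in> code_supp D" for i
    using someI_ex[OF ex[OF that]] by (auto simp: rep_def)
  define R where "R = (\<lambda>i. rep (cls i)) ` code_supp D"
  have cls_sub: "cls i \<subseteq> code_supp D" for i by (auto simp: cls_def)
  have R_supp: "R \<subseteq> code_supp D" using rep cls_sub by (auto simp: R_def)
  have rep_R: "rep (cls i) = i" if i: "i \<in> R" for i
  proof -
    obtain l where l: "l \<in> code_supp D" "i = rep (cls l)" using i by (auto simp: R_def)
    then have "cls i = cls l" using cls_eq[OF l(1) rep(1)[OF l(1)]] by (simp only:)
    then show ?thesis using l(2) by (simp only:)
  qed
  have finR: "finite R" using D'(3) by (simp add: R_def)
  have "card {i\<in>R. g i \<noteq> 0} = ?q ^ 2" if g: "g \<in> D - {0}" for g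
  proof -
    have same: "g l \<noteq> 0 \<longleftrightarrow> g i \<noteq> 0" if "i \<in> code_supp D" "l \<in> cls i" for i l
      using shorten_eq[OF that] g by (auto simp: shorten_def)
    have supp: "{l. g l \<noteq> 0} = (\<Union>i\<in>{i\<in>R. g i \<noteq> 0}. cls i)"
    proof (intro equalityI subsetI)
      fix l assume l: "l \<in> {l. g l \<noteq> 0}"
      then have lD: "l \<in> code_supp D" using g by (auto simp: code_supp_def)
      then have "rep (cls l) \<in> R" "l \<in> cls (rep (cls l))"
        using cls_eq[OF lD rep(1)[OF lD]] self[OF lD] lD by (simp_all add: R_def)
      moreover have "g (rep (cls l)) \<noteq> 0"
        using same[OF lD rep(1)[OF lD]] l by simp
      ultimately show "l \<in> (\<Union>i\<in>{i\<in>R. g i \<noteq> 0}. cls i)" by auto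
    qed (use same R_supp in auto)
    have union: "card (\<Union>i\<in>{i\<in>R. g i \<noteq> 0}. cls i) = (\<Sum>i\<in>{i\<in>R. g i \<noteq> 0}. card (cls i))"
    proof (rule card_UN_disjoint)
      show "\<forall>i\<in>{i\<in>R. g i \<noteq> 0}. \<forall>j\<in>{i\<in>R. g i \<noteq> 0}. i \<noteq> j \<longrightarrow> cls i \<inter> cls j = {}"
      proof (intro ballI impI, rule ccontr)
        fix i j assume "i \<in> {i\<in>R. g i \<noteq> 0}" "j \<in> {i\<in>R. g i \<noteq> 0}" "i \<noteq> j" "cls i \<inter> cls j \<noteq> {}"
        moreover from this obtain l where "l \<in> cls i" "l \<in> cls j" by auto
        ultimately have ij: "i \<in> R" "j \<in> R" "i \<in> code_supp D" "j \<in> code_supp D"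
          and l: "l \<in> cls i" "l \<in> cls j" and "i \<noteq> j"
          using R_supp by auto
        have "cls i = cls j" using cls_eq[OF ij(3) l(1)] cls_eq[OF ij(4) l(2)] by (rule trans[OF sym])
        then have "i = j" using rep_R[OF ij(1)] rep_R[OF ij(2)] by (metis (no_types))
        then show False using \<open>i \<noteq> j\<close> by contradiction
      qed
    qed (use finR D'(3) in \<open>auto simp: cls_def\<close>)
    have const: "(\<Sum>i\<in>{i\<in>R. g i \<noteq> 0}. card (cls i)) = (\<Sum>i\<in>{i\<in>R. g i \<noteq> 0}. m)"
      using card_cls R_supp by (intro sum.cong) auto
    have "card {i\<in>R. g i \<noteq> 0} * m = hamming_weight g"
      unfolding hamming_weight_def supp union const by simp
    also have "hamming_weight g = d" using wt[of g] g by blast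
    finally show ?thesis using m0 m by (simp add: mult.commute)
  qed
  moreover have "\<exists>x\<in>D. x i = 0 \<and> x j \<noteq> 0" if ij: "i \<in> R" "j \<in> R" "i \<noteq> j" for i j
  proof (rule ccontr)
    assume "\<not> ?thesis"
    then have "j \<in> cls i" using ij(2) R_supp by (auto simp: cls_def code_supp_def shorten_def)
    with ij(1) R_supp have "cls j = cls i" by (intro cls_eq) auto
    then show False using rep_R[OF ij(1)] rep_R[OF ij(2)] ij(3) by simp
  qed
  moreover have "R \<subseteq> max_coords (Suc k) d C \<inter> code_supp D"
    using rep(2) R_supp by (auto simp: R_def)
  ultimately show ?thesis by (intro exI[of _ R]) blast
qed

text \<open>The form \<open>g i * c j - g j * c i\<close> is onto, already on multiples of
  \<open>x\<close>, so its kernel has \<open>q ^ 2\<close> words. Those with \<open>g i = 0\<close>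
  also have \<open>g j = 0\<close>, and there are \<open>q\<close> of them. This is the off-diagonal
  term of the second moment below.\<close>

lemma card_shorten_two:
  fixes D :: "(nat \<Rightarrow> 'a::{field,finite}) set"
  assumes D: "fvec.subspace D" "card D = CARD('a) ^ 3" and x: "x \<in> D" "x i = 0" "x j \<noteq> 0"
    and y: "y \<in> D" "y i \<noteq> 0" and c: "c i \<noteq> (0 :: 'a)"
  shows "card {g\<in>D. g i \<noteq> 0 \<and> g i * c j = g j * c i} = CARD('a) ^ 2 - CARD('a)"
proof -
  let ?f = "\<lambda>g. g i * c j - g j * c i"
  have finD: "finite D" using D(2) card_gt_0_iff[of D] by simp
  have "a \<in> ?f ` D" for a
  proof -
    have "vscale (- a / (x j * c i)) x \<in> D" using D(1) x(1) by (rule fvec.subspace_scale)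
    then show ?thesis using x c by (force simp: vscale_apply intro: rev_image_eqI)
  qed
  then have "?f ` D = UNIV" by auto
  then have M: "card {g\<in>D. ?f g = 0} = CARD('a) ^ 2"
    using card_additive_image[OF D(1) finD, of ?f] D(2) by (simp add: algebra_simps eval_nat_numeral)
  have "i \<in> code_supp D" using y by (auto simp: code_supp_def)
  then have E: "card (shorten D i) = CARD('a) ^ Suc 1" and
    F: "j \<in> code_supp (shorten D i)"
    using card_shorten_pow[OF D(1), of 2 i] D(2) x by (auto simp: code_supp_def shorten_def eval_nat_numeral)
  have "card (shorten (shorten D i) j) = CARD('a)"
    using card_shorten_pow[OF subspace_shorten[OF D(1)] E F] by simp
  moreover have "{g\<in>D. g i \<noteq> 0 \<and> g i * c j = g j * c i} = {g\<in>D. ?f g = 0} - shorten (shorten D i) j"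
    using c by (auto simp: shorten_def)
  moreover have "shorten (shorten D i) j \<subseteq> {g\<in>D. ?f g = 0}"
    by (auto simp: shorten_def)
  ultimately show ?thesis
    using M finD by (simp add: card_Diff_subset finite_subset[of _ D] shorten_def)
qed

text \<open>With \<open>N g a\<close> the number of \<open>i \<in> R\<close> of ratio \<open>a\<close>, the average over \<open>g \<noteq> 0\<close> of
  \<open>\<Sum>a\<noteq>0. (N g a - (q + 2))\<^sup>2\<close> is \<open>q\<^sup>2 - 4\<close>, but one missed ratio alone contributes \<open>(q + 2)\<^sup>2\<close>.\<close>

lemma ex_all_ratios:
  fixes D :: "(nat \<Rightarrow> 'a::{field,finite}) set"
  assumes D: "fvec.subspace D" "card D = CARD('a) ^ 3" and R: "finite R" "R \<subseteq> code_supp D"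
    and c: "\<forall>i\<in>R. c i \<noteq> 0"
    and wt: "\<forall>g\<in>D - {0}. card {i\<in>R. g i \<noteq> 0} = CARD('a) ^ 2"
    and indep: "\<forall>i\<in>R. \<forall>j\<in>R. i \<noteq> j \<longrightarrow> (\<exists>x\<in>D. x i = 0 \<and> x j \<noteq> 0)"
  shows "\<exists>g\<in>D - {0}. \<forall>a. \<exists>i\<in>R. g i = a * c i"
proof (rule ccontr)
  assume neg: "\<not> ?thesis"
  define q where "q = int CARD('a)"
  have q2: "q \<ge> 2" using q_ge_2[where 'a = 'a] by (simp add: q_def)
  have finD: "finite D" using D(2) card_gt_0_iff[of D] by simp
  have 0: "0 \<in> D" using D(1) by (rule fvec.subspace_0)
  have cardD0: "int (card (D - {0})) = q ^ 3 - 1"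
    using finD 0 D(2) by (simp add: card_Diff_singleton of_nat_diff q_def)
  define N where "N g a = (\<Sum>i\<in>R. of_bool (g i = a * c i) :: int)" for g a
  let ?A = "UNIV - {0 :: 'a}"
  have cardA: "int (card ?A) = q - 1"
    by (simp add: card_Diff_singleton of_nat_diff q_def)
  define r where "r = int (card R)"
  have wt': "(\<Sum>i\<in>R. of_bool (g i \<noteq> 0) :: int) = q ^ 2" if "g \<in> D - {0}" for g
  proof -
    have "R \<inter> {i. g i \<noteq> 0} = {i\<in>R. g i \<noteq> 0}" by auto
    then show ?thesis using wt that R(1) by (simp add: sum_of_bool_eq q_def del: of_bool_not_iff)
  qed
  have col: "(\<Sum>g\<in>D. of_bool (g i \<noteq> 0) :: int) = q ^ 3 - q ^ 2" if "i \<in> R" for i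
  proof -
    have "card (shorten D i) = CARD('a) ^ 2"
      using card_shorten_pow[OF D(1), of 2 i] D(2) R(2) that by (auto simp: eval_nat_numeral)
    moreover have "D \<inter> {g. g i \<noteq> 0} = D - shorten D i" by (auto simp: shorten_def)
    ultimately show ?thesis
      using finD D(2) shorten_subset[of D i]
      by (simp add: sum_of_bool_eq card_Diff_subset finite_subset of_nat_diff power_increasing q_def del: of_bool_not_iff)
  qed
  \<comment> \<open>Counting nonzero entries of \<open>D\<close> on \<open>R\<close> in two ways
    gives \<open>r\<close>, the number of points of a projective plane.\<close>
  have "r * (q ^ 3 - q ^ 2) = (\<Sum>i\<in>R. \<Sum>g\<in>D. of_bool (g i \<noteq> 0))"
    using col by (simp add: r_def)
  also have "\<dots> = (\<Sum>g\<in>D. \<Sum>i\<in>R. of_bool (g i \<noteq> 0))" by (rule sum.swap)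
  also have "\<dots> = (\<Sum>g\<in>D - {0}. \<Sum>i\<in>R. of_bool (g i \<noteq> 0))"
    using finD by (intro sum.mono_neutral_right) auto
  also have "\<dots> = (q ^ 3 - 1) * q ^ 2"
    using wt' cardD0 by simp
  finally have "(r - (q ^ 2 + q + 1)) * ((q - 1) * q ^ 2) = 0"
    by (simp add: algebra_simps eval_nat_numeral)
  then have r: "r = q ^ 2 + q + 1" using q2 by auto
  have N1: "(\<Sum>a\<in>?A. N g a) = q ^ 2" if g: "g \<in> D - {0}" for g
  proof -
    have "(\<Sum>a\<in>?A. of_bool (g i = a * c i) :: int) = of_bool (g i \<noteq> 0)" if i: "i \<in> R" for i
    proof -
      have "g i = a * c i \<longleftrightarrow> a = g i / c i" for a using c i by (auto simp: field_simps)
      then show ?thesis using c i by (simp add: of_bool_def)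
    qed
    then show ?thesis
      unfolding N_def using wt'[OF g] by (subst sum.swap) simp
  qed
  \<comment> \<open>The square counts pairs \<open>i\<close>, \<open>j\<close> that both have ratio
    \<open>a\<close>; exchanging the sums lets each pair be evaluated separately.\<close>
  have N2: "(\<Sum>g\<in>D - {0}. \<Sum>a\<in>?A. N g a ^ 2) = (q ^ 3 - 1) * (q ^ 2 * (q + 2))"
  proof -
    have pair: "(\<Sum>g\<in>D. \<Sum>a\<in>?A. of_bool (g i = a * c i) * of_bool (g j = a * c j) :: int)
        = (if i = j then q ^ 3 - q ^ 2 else q ^ 2 - q)" if ij: "i \<in> R" "j \<in> R" for i j
    proof -
      have "(\<Sum>a\<in>?A. of_bool (g i = a * c i) * of_bool (g j = a * c j) :: int)
          = of_bool (g i \<noteq> 0 \<and> g i * c j = g j * c i)" for g :: "nat \<Rightarrow> 'a"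
      proof -
        have "of_bool (g i = a * c i) * of_bool (g j = a * c j) =
            (if a = g i / c i then of_bool (g i * c j = g j * c i) else 0 :: int)" for a
        proof (cases "a = g i / c i")
          case True
          then have "g i = a * c i" using c ij by simp
          moreover have "g j = a * c j \<longleftrightarrow> g i * c j = g j * c i"
          proof -
            have "g i * c j = c i * (a * c j)" using \<open>g i = a * c i\<close> by (simp add: mult_ac)
            then have "g i * c j = g j * c i \<longleftrightarrow> c i * (a * c j) = c i * g j"
              by (simp only: mult.commute[of "g j"])
            then show ?thesis using c ij by auto
          qed
          ultimately show ?thesis using True by simp
        next
          case False
          then have "g i \<noteq> a * c i" using c ij by auto
          then show ?thesis using False by simp
        qed
        then show ?thesis using c ij by (simp add: of_bool_def)
      qed
      then have "(\<Sum>g\<in>D. \<Sum>a\<in>?A. of_bool (g i = a * c i) * of_bool (g j = a * c j) :: int)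
          = (\<Sum>g\<in>D. of_bool (g i \<noteq> 0 \<and> g i * c j = g j * c i))" by simp
      also have "\<dots> = (if i = j then q ^ 3 - q ^ 2 else q ^ 2 - q)"
      proof (cases "i = j")
        case True
        then show ?thesis using col[OF ij(1)] by simp
      next
        case False
        obtain x where x: "x \<in> D" "x i = 0" "x j \<noteq> 0" using indep ij False by auto
        obtain y where y: "y \<in> D" "y i \<noteq> 0" using R(2) ij(1) by (auto simp: code_supp_def)
        have "D \<inter> {g. g i \<noteq> 0 \<and> g i * c j = g j * c i} = {g\<in>D. g i \<noteq> 0 \<and> g i * c j = g j * c i}"
          by auto
        then show ?thesis
          using card_shorten_two[OF D x y] c ij(1) finD False
          by (simp add: sum_of_bool_eq of_nat_diff q_def power2_eq_square)
      qed
      finally show ?thesis .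
    qed
    have N0: "(\<Sum>a\<in>?A. N 0 a ^ 2) = 0"
      unfolding N_def using c by (auto intro!: sum.neutral)
    have "(\<Sum>g\<in>D - {0}. \<Sum>a\<in>?A. N g a ^ 2) = (\<Sum>g\<in>D. \<Sum>a\<in>?A. N g a ^ 2)"
      using finD N0 by (intro sum.mono_neutral_left) auto
    also have "\<dots> = (\<Sum>g\<in>D. \<Sum>a\<in>?A. \<Sum>i\<in>R. \<Sum>j\<in>R. of_bool (g i = a * c i) * of_bool (g j = a * c j))"
      unfolding N_def power2_eq_square sum_product by simp
    also have "\<dots> = (\<Sum>g\<in>D. \<Sum>i\<in>R. \<Sum>a\<in>?A. \<Sum>j\<in>R. of_bool (g i = a * c i) * of_bool (g j = a * c j))"
      by (intro sum.cong refl sum.swap)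
    also have "\<dots> = (\<Sum>g\<in>D. \<Sum>i\<in>R. \<Sum>j\<in>R. \<Sum>a\<in>?A. of_bool (g i = a * c i) * of_bool (g j = a * c j))"
      by (intro sum.cong refl sum.swap)
    also have "\<dots> = (\<Sum>i\<in>R. \<Sum>g\<in>D. \<Sum>j\<in>R. \<Sum>a\<in>?A. of_bool (g i = a * c i) * of_bool (g j = a * c j))"
      by (rule sum.swap)
    also have "\<dots> = (\<Sum>i\<in>R. \<Sum>j\<in>R. \<Sum>g\<in>D. \<Sum>a\<in>?A. of_bool (g i = a * c i) * of_bool (g j = a * c j))"
      by (intro sum.cong refl sum.swap)
    also have "\<dots> = (\<Sum>i\<in>R. \<Sum>j\<in>R. (q ^ 2 - q) + (if i = j then q ^ 3 - 2 * q ^ 2 + q else 0))"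
      by (intro sum.cong refl, subst pair) auto
    also have "\<dots> = r * (r * (q ^ 2 - q) + (q ^ 3 - 2 * q ^ 2 + q))"
      using R(1) by (simp add: sum.distrib r_def)
    also have "\<dots> = (q ^ 3 - 1) * (q ^ 2 * (q + 2))"
      unfolding r by (simp add: algebra_simps eval_nat_numeral)
    finally show ?thesis .
  qed
  have miss: "(q + 2) ^ 2 \<le> (\<Sum>a\<in>?A. (N g a - (q + 2)) ^ 2)" if g: "g \<in> D - {0}" for g
  proof -
    obtain a where a: "\<forall>i\<in>R. g i \<noteq> a * c i" using neg g by blast
    \<comment> \<open>Missing the ratio 0 would make \<open>g\<close> nonzero at all
      \<open>q ^ 2 + q + 1\<close> coordinates of \<open>R\<close>, but it is nonzero at only
      \<open>q ^ 2\<close>.\<close>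
    have "a \<noteq> 0"
    proof
      assume "a = 0"
      then have "{i\<in>R. g i \<noteq> 0} = R" using a by auto
      moreover have "card {i\<in>R. g i \<noteq> 0} = CARD('a) ^ 2" using wt g by (rule bspec)
      ultimately have "r = q ^ 2" by (simp add: r_def q_def)
      then show False using r q2 by simp
    qed
    have "N g a = 0" using a by (simp add: N_def)
    then have "(q + 2) ^ 2 = (N g a - (q + 2)) ^ 2" by (simp add: power2_eq_square algebra_simps)
    also have "\<dots> \<le> (\<Sum>a\<in>?A. (N g a - (q + 2)) ^ 2)"
      using \<open>a \<noteq> 0\<close> by (intro member_le_sum) auto
    finally show ?thesis .
  qed
  \<comment> \<open>The centre \<open>q + 2\<close> is the mean \<open>q ^ 2 / (q - 1)\<close> of
    \<open>N g a\<close> over nonzero \<open>a\<close>, rounded up. Summing \<open>miss\<close> over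
    all \<open>g\<close> and evaluating by \<open>N1\<close> and \<open>N2\<close> leads to a
    contradiction.\<close>
  have "(q ^ 3 - 1) * (q + 2) ^ 2 = (\<Sum>g\<in>D - {0}. (q + 2) ^ 2)"
    using cardD0 by simp
  also have "\<dots> \<le> (\<Sum>g\<in>D - {0}. \<Sum>a\<in>?A. (N g a - (q + 2)) ^ 2)"
    by (intro sum_mono miss)
  also have "\<dots> = (\<Sum>g\<in>D - {0}. (\<Sum>a\<in>?A. N g a ^ 2) + ((q - 1) * (q + 2) ^ 2 - 2 * (q + 2) * q ^ 2))"
  proof (intro sum.cong refl)
    fix g assume g: "g \<in> D - {0}"
    have "(\<Sum>a\<in>?A. (N g a - (q + 2)) ^ 2)
        = (\<Sum>a\<in>?A. N g a ^ 2 - 2 * (q + 2) * N g a + (q + 2) ^ 2)"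
      by (intro sum.cong refl) (simp add: power2_eq_square algebra_simps)
    also have "\<dots> = (\<Sum>a\<in>?A. N g a ^ 2) - 2 * (q + 2) * (\<Sum>a\<in>?A. N g a) + (q - 1) * (q + 2) ^ 2"
      using cardA by (simp add: sum.distrib sum_subtractf sum_distrib_left)
    finally show "(\<Sum>a\<in>?A. (N g a - (q + 2)) ^ 2)
        = (\<Sum>a\<in>?A. N g a ^ 2) + ((q - 1) * (q + 2) ^ 2 - 2 * (q + 2) * q ^ 2)"
      by (simp add: N1[OF g])
  qed
  also have "\<dots> = (q ^ 3 - 1) * (q ^ 2 * (q + 2))
      + (q ^ 3 - 1) * ((q - 1) * (q + 2) ^ 2 - 2 * (q + 2) * q ^ 2)"
    by (simp only: sum.distrib N2 sum_constant cardD0)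
  also have "\<dots> = (q ^ 3 - 1) * ((q + 2) * (q - 2))"
    by (simp add: algebra_simps eval_nat_numeral)
  finally have "(q ^ 3 - 1) * (q + 2) ^ 2 \<le> (q ^ 3 - 1) * ((q + 2) * (q - 2))" .
  moreover have "q ^ 3 - 1 > 0" using q2 by simp
  ultimately have "(q + 2) ^ 2 \<le> (q + 2) * (q - 2)" by simp
  then show False using q2 by (simp add: power2_eq_square)
qed

subsection \<open>Interpolation at coordinates\<close>

text \<open>A word \<open>z\<close> nonzero at some \<open>i\<close> in \<open>S\<close> gives one
  more free coordinate: a multiple of \<open>z\<close> sets the value at \<open>i\<close>, and a
  word of \<open>shorten C i\<close> corrects the others without disturbing it.\<close>

lemma ex_interpolation_set:
  fixes C :: "(nat \<Rightarrow> 'a::{field,finite}) set"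
  assumes "fvec.subspace C" "card C = CARD('a) ^ k"
    and "\<forall>x\<in>C. (\<forall>i\<in>S. x i = 0) \<longrightarrow> x = 0"
  shows "\<exists>T\<subseteq>S. finite T \<and> card T = k \<and> (\<forall>v. \<exists>c\<in>C. \<forall>i\<in>T. c i = v i)"
  using assms
proof (induction k arbitrary: C)
  case 0
  then show ?case
    using fvec.subspace_0[OF 0(1)] by (intro exI[of _ "{}"]) auto
next
  case (Suc k)
  obtain z where z: "z \<in> C" "z \<noteq> 0" using ex_nonzero_word[OF Suc.prems(2)] .
  then obtain i where i: "i \<in> S" "z i \<noteq> 0" using Suc.prems(3) by blast
  let ?D = "shorten C i"
  have iC: "i \<in> code_supp C" using z i by (auto simp: code_supp_def)
  have *: "\<forall>x\<in>?D. (\<forall>i\<in>S. x i = 0) \<longrightarrow> x = 0"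
    using Suc.prems(3) shorten_subset by blast
  obtain T where T: "T \<subseteq> S" "finite T" "card T = k" "\<And>v. \<exists>c\<in>?D. \<forall>i\<in>T. c i = v i"
    using Suc.IH[OF subspace_shorten[OF Suc.prems(1)] card_shorten_pow[OF Suc.prems(1,2) iC] *]
    by blast
  \<comment> \<open>Words of the shortened code vanish at \<open>i\<close>, yet on \<open>T\<close>
    they can take the value 1.\<close>
  have "i \<notin> T"
    using T(4)[of "\<lambda>_. 1"] by (auto simp: shorten_def)
  moreover have "\<exists>c\<in>C. \<forall>j\<in>insert i T. c j = v j" for v
  proof -
    let ?z = "vscale (v i / z i) z"
    obtain y where y: "y \<in> ?D" "\<forall>j\<in>T. y j = v j - ?z j"
      using T(4)[of "\<lambda>j. v j - ?z j"] by blast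
    have "?z + y \<in> C"
      using y(1) z(1) Suc.prems(1) by (simp add: shorten_def fvec.subspace_add fvec.subspace_scale)
    moreover have "(?z + y) j = v j" if "j \<in> insert i T" for j
      using that y i(2) by (auto simp: shorten_def vscale_apply)
    ultimately show ?thesis by blast
  qed
  ultimately show ?case
    using T(1-3) i(1) by (intro exI[of _ "insert i T"]) auto
qed

text \<open>Each word \<open>z + vscale a c\<close> has a zero in \<open>S\<close>, namely where the
  ratio is \<open>- a\<close>, so \<open>m\<close> divides its weight. In
  \<open>sum_weight_line\<close> only \<open>hamming_weight c\<close> and the union term
  remain.\<close>

lemma weight_dvd_of_all_ratios:
  fixes C :: "(nat \<Rightarrow> 'a::{field,finite}) set"
  assumes C: "fvec.subspace C" "finite (code_supp C)" and cz: "c \<in> C" "z \<in> C"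
    and ratios: "\<forall>a. \<exists>i\<in>S. z i = a * c i"
    and dvd: "\<And>x i. x \<in> C \<Longrightarrow> i \<in> S \<Longrightarrow> x i = 0 \<Longrightarrow> m dvd hamming_weight x"
    and union: "m dvd CARD('a) * card {i. z i \<noteq> 0 \<or> c i \<noteq> 0}"
  shows "m dvd hamming_weight c"
proof -
  have "m dvd hamming_weight (z + vscale a c)" for a
  proof -
    obtain i where "i \<in> S" "z i = - a * c i" using ratios by blast
    then show ?thesis
      using C(1) cz by (intro dvd[of _ i]) (auto simp: vscale_apply fvec.subspace_add fvec.subspace_scale)
  qed
  then have "m dvd (\<Sum>a\<in>UNIV. hamming_weight (z + vscale a c))"
    by (intro dvd_sum) simp
  moreover have "m dvd (\<Sum>a\<in>UNIV. hamming_weight (z + vscale a c)) + hamming_weight c"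
    using union sum_weight_line[of z c] finite_word_supp[OF C(2)] cz by simp
  ultimately show ?thesis by (simp only: dvd_add_right_iff)
qed

subsection \<open>Change of coordinates\<close>

lemma meets_griesmer_of_griesmer_code:
  fixes C :: "(nat \<Rightarrow> 'a::{field,finite}) set"
  assumes "griesmer_code k d C"
  shows "meets_griesmer k d C"
proof -
  let ?n = "griesmer_length CARD('a) k d"
  have C: "C \<subseteq> coord_space ?n" "fvec.subspace C" "fvec.dim C = k" "is_min_weight C d" "full_length ?n C"
    using assms by (auto simp: griesmer_code_def linear_code_def)
  have "finite {x :: nat \<Rightarrow> 'a. \<forall>i. (i \<in> {..<?n} \<longrightarrow> x i \<in> UNIV) \<and> (i \<notin> {..<?n} \<longrightarrow> x i = 0)}"
    by (rule finite_set_of_finite_funs) auto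
  then have "finite (coord_space ?n :: (nat \<Rightarrow> 'a) set)"
    by (rule finite_subset[rotated]) (auto simp: coord_space_def)
  then have "finite C" using C(1) finite_subset by blast
  then have "card C = CARD('a) ^ k" using card_subspace_eq_dim[OF C(2)] C(3) by simp
  moreover have "code_supp C = {..<?n}"
  proof (intro equalityI subsetI)
    fix i assume "i \<in> code_supp C"
    then obtain c where "c \<in> C" "c i \<noteq> 0" by (auto simp: code_supp_def)
    moreover from this have "c \<in> coord_space ?n" using C(1) by blast
    ultimately show "i \<in> {..<?n}" by (auto simp: coord_space_def intro: ccontr)
  qed (use C(5) in \<open>auto simp: full_length_def code_supp_def\<close>)
  ultimately show ?thesis
    using C(2,4) by (simp add: meets_griesmer_def is_min_weight_def)
qed

text \<open>Shortening leaves gaps in the support, while the hypothesis on small dimensions concerns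
  codes on an initial segment of coordinates; enumerating the support closes the gaps. Positive
  dimension provides a word of weight exactly \<open>d\<close>.\<close>

lemma ex_equivalent_griesmer_code:
  fixes C :: "(nat \<Rightarrow> 'a::{field,finite}) set"
  assumes "meets_griesmer (Suc k) d C"
  shows "\<exists>C' :: (nat \<Rightarrow> 'a) set. griesmer_code (Suc k) d C' \<and> hamming_weight ` C \<subseteq> hamming_weight ` C'"
proof -
  note C = meets_griesmerD[OF assms]
  let ?n = "griesmer_length CARD('a) (Suc k) d"
  obtain h where h: "bij_betw h {0..<?n} (code_supp C)"
    using ex_bij_betw_nat_finite[OF C(3)] C(5) by auto
  define T where "T x = (\<lambda>i. if i < ?n then x (h i) else 0)" for x :: "nat \<Rightarrow> 'a"
  have add: "T (x + y) = T x + T y" and diff: "T (x - y) = T x - T y"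
    and scale: "T (vscale a x) = vscale a (T x)" for x y a
    by (auto simp: T_def fun_eq_iff vscale_apply)
  have T_weight: "hamming_weight (T x) = hamming_weight x" if x: "x \<in> C" for x
  proof -
    have "bij_betw h {i. T x i \<noteq> 0} {i. x i \<noteq> 0}"
      unfolding bij_betw_def
    proof (intro conjI equalityI subsetI)
      show "inj_on h {i. T x i \<noteq> 0}"
        using h by (auto simp: T_def bij_betw_def intro: inj_on_subset split: if_splits)
      fix i assume i: "i \<in> {i. x i \<noteq> 0}"
      then have "i \<in> h ` {0..<?n}" using h x by (auto simp: bij_betw_def code_supp_def)
      then show "i \<in> h ` {i. T x i \<noteq> 0}" using i by (auto simp: T_def)
    qed (auto simp: T_def split: if_splits)
    then show ?thesis by (simp add: hamming_weight_def bij_betw_same_card)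
  qed
  have T_eq_0: "T x = 0 \<longleftrightarrow> x = 0" if x: "x \<in> C" for x
  proof
    assume "T x = 0"
    then have "hamming_weight x = 0" using T_weight[OF x] by (simp add: hamming_weight_def)
    then show "x = 0" using hamming_weight_eq_0_iff[OF C(7)[OF x]] by simp
  qed (simp add: T_def fun_eq_iff)
  have sub: "fvec.subspace (T ` C)"
    unfolding fvec.subspace_def
  proof (intro conjI ballI allI)
    show "0 \<in> T ` C"
      using fvec.subspace_0[OF C(1)] by (intro image_eqI[of _ _ 0]) (auto simp: T_def fun_eq_iff)
  qed (auto simp: add[symmetric] scale[symmetric]
      intro!: imageI fvec.subspace_add[OF C(1)] fvec.subspace_scale[OF C(1)])
  have "inj_on T C"
  proof (rule inj_onI)
    fix x y assume xy: "x \<in> C" "y \<in> C" "T x = T y"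
    then have "x - y \<in> C" "T (x - y) = 0"
      using C(1) by (simp_all add: diff fvec.subspace_diff)
    then show "x = y" using T_eq_0 by auto
  qed
  then have "card (T ` C) = CARD('a) ^ Suc k" using C(2) by (simp add: card_image)
  moreover have "card (T ` C) = CARD('a) ^ fvec.dim (T ` C)"
    using card_subspace_eq_dim[OF sub] C(6) by simp
  ultimately have "fvec.dim (T ` C) = Suc k"
    using q_ge_2[where 'a = 'a] by (metis Suc_1 Suc_le_lessD power_inject_exp)
  moreover have "is_min_weight (T ` C) d"
  proof -
    obtain c where "c \<in> C - {0}" "hamming_weight c = d" using ex_min_weight_word[OF assms] by auto
    then have "T c \<in> T ` C - {0}" "hamming_weight (T c) = d" using T_eq_0 T_weight by auto
    moreover have "d \<le> hamming_weight y" if "y \<in> T ` C - {0}" for y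
      using that C(4) T_eq_0 T_weight by auto
    ultimately show ?thesis unfolding is_min_weight_def by blast
  qed
  moreover have "full_length ?n (T ` C)"
    unfolding full_length_def
  proof (intro allI impI)
    fix i assume i: "i < ?n"
    then have "h i \<in> code_supp C" using h by (auto simp: bij_betw_def)
    then show "\<exists>c\<in>T ` C. c i \<noteq> 0" using i by (auto simp: code_supp_def T_def)
  qed
  moreover have "T ` C \<subseteq> coord_space ?n" by (auto simp: coord_space_def T_def)
  ultimately have "griesmer_code (Suc k) d (T ` C)"
    using sub by (simp add: griesmer_code_def linear_code_def)
  moreover have "hamming_weight x \<in> hamming_weight ` T ` C" if "x \<in> C" for x
    using T_weight[OF that] that by (metis imageI)
  ultimately show ?thesis by blast
qed

subsection \<open>The induction on the dimension\<close>

text \<open>The exponent \<open>e + 1 - f\<close> stands for the quotient of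
  \<open>p ^ (e + 1)\<close> by \<open>q\<close>. \<open>IH\<close> covers all \<open>d\<close> and
  \<open>e\<close>, since the residual code replaces them by \<open>d div q\<close> and
  \<open>e - f\<close>.\<close>

lemma griesmer_divisibility_step:
  fixes C :: "(nat \<Rightarrow> 'a::{field,finite}) set"
  assumes p: "prime p" and q: "CARD('a) = p ^ f"
    and IH: "\<And>d e (C :: (nat \<Rightarrow> 'a) set) c. 1 \<le> d \<Longrightarrow> p ^ e dvd d \<Longrightarrow> f \<le> e \<Longrightarrow>
      meets_griesmer k d C \<Longrightarrow> c \<in> C \<Longrightarrow> p ^ (e + 1 - f) dvd hamming_weight c"
    and k: "CARD('a) \<le> Suc k" and d: "1 \<le> d" "p ^ e dvd d" and e: "f \<le> e"
    and C: "meets_griesmer (Suc k) d C" and c: "c \<in> C"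
  shows "p ^ (e + 1 - f) dvd hamming_weight c"
proof -
  note C' = meets_griesmerD[OF C]
  let ?S = "max_coords (Suc k) d C"
  have f: "f \<ge> 1"
  proof (rule ccontr)
    assume "\<not> f \<ge> 1"
    then have "f = 0" by simp
    then show False using q q_ge_2[where 'a = 'a] by simp
  qed
  have van: "p ^ (e + 1 - f) dvd hamming_weight x" if "x \<in> C" "i \<in> ?S" "x i = 0" for x i
    using IH[OF d e, of "shorten C i" x] that by (simp add: max_coords_def shorten_def)
  have span: "\<forall>x\<in>C. (\<forall>i\<in>?S. x i = 0) \<longrightarrow> x = 0"
    using max_coords_spanning[OF C d(1)] by auto
  \<comment> \<open>If \<open>e < 2 * f\<close>, the divisor to be shown divides \<open>q\<close>;
    otherwise \<open>q ^ 2\<close> divides \<open>d\<close>. Dimension two is set apart because the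
    last case needs a three-dimensional subcode.\<close>
  consider (zero) "\<exists>i\<in>?S. c i = 0" | (small) "\<forall>i\<in>?S. c i \<noteq> 0" "e < 2 * f"
    | (plane) "2 * f \<le> e" "k = 1" | (large) "\<forall>i\<in>?S. c i \<noteq> 0" "2 * f \<le> e" "k \<ge> 2"
  proof -
    have "k \<ge> 1" using k q_ge_2[where 'a = 'a] by simp
    then have "e < 2 * f \<or> 2 * f \<le> e \<and> k = 1 \<or> 2 * f \<le> e \<and> k \<ge> 2" by linarith
    then show thesis using that by blast
  qed
  then show ?thesis
  proof cases
    case zero
    then show ?thesis using van c by auto
  next
    case small
    obtain T where T: "T \<subseteq> ?S" "finite T" "card T = Suc k" "\<And>v. \<exists>z\<in>C. \<forall>i\<in>T. z i = v i"
      using ex_interpolation_set[OF C'(1,2) span] by auto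
    \<comment> \<open>As \<open>T\<close> has at least \<open>q\<close> elements, each ratio
      \<open>a\<close> gets its own coordinate \<open>h a\<close>. Outside the range of
      \<open>h\<close> the value of \<open>inv h\<close> is arbitrary, which does no harm.\<close>
    obtain h :: "'a \<Rightarrow> nat" where h: "range h \<subseteq> T" "inj h"
      using card_le_inj[of "UNIV :: 'a set" T] T(2,3) k by auto
    obtain z where z: "z \<in> C" "\<forall>i\<in>T. z i = inv h i * c i"
      using T(4)[of "\<lambda>i. inv h i * c i"] by auto
    have ratios: "\<forall>a. \<exists>i\<in>?S. z i = a * c i"
    proof
      fix a
      have "z (h a) = inv h (h a) * c (h a)" using z(2) h(1) by blast
      then show "\<exists>i\<in>?S. z i = a * c i"
        using h T(1) by (intro bexI[of _ "h a"]) auto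
    qed
    have "p ^ (e + 1 - f) dvd CARD('a)"
      using small(2) f unfolding q by (intro le_imp_power_dvd) simp
    then have union: "p ^ (e + 1 - f) dvd CARD('a) * card {i. z i \<noteq> 0 \<or> c i \<noteq> 0}"
      by (rule dvd_mult2)
    show ?thesis
      by (rule weight_dvd_of_all_ratios[OF C'(1,3) c z(1) ratios van union])
  next
    case plane
    have "p ^ f dvd d" using e by (intro dvd_trans[OF le_imp_power_dvd d(2)])
    then have "hamming_weight c = d" if "c \<noteq> 0"
      using constant_weight[OF C _ c that] plane(2) q by simp
    moreover have "p ^ (e + 1 - f) dvd d"
      using f by (intro dvd_trans[OF le_imp_power_dvd d(2)]) simp
    moreover have "hamming_weight (0 :: nat \<Rightarrow> 'a) = 0" by (simp add: hamming_weight_def)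
    ultimately show ?thesis by (cases "c = 0") auto
  next
    case large
    obtain D where D: "D \<subseteq> C" "meets_griesmer (Suc (Suc (Suc 0))) d D"
      using meets_griesmer_subcode[OF C, of "Suc (Suc (Suc 0))"] large(3) d(1) by auto
    note D' = meets_griesmerD[OF D(2)]
    have "p ^ (2 * f) dvd d" using large(2) by (intro dvd_trans[OF le_imp_power_dvd d(2)])
    then have q2: "CARD('a) ^ 2 dvd d" by (simp add: q power_mult[symmetric] mult.commute)
    then have q1: "CARD('a) dvd d" by (simp add: power2_eq_square dvd_mult_left)
    obtain R where R: "R \<subseteq> ?S \<inter> code_supp D" "\<forall>g\<in>D - {0}. card {i\<in>R. g i \<noteq> 0} = CARD('a) ^ 2"
      "\<forall>i\<in>R. \<forall>j\<in>R. i \<noteq> j \<longrightarrow> (\<exists>x\<in>D. x i = 0 \<and> x j \<noteq> 0)"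
      using ex_transversal[OF C d(1) D(2,1) q2] by blast
    have "\<exists>z\<in>D - {0}. \<forall>a. \<exists>i\<in>R. z i = a * c i"
    proof (rule ex_all_ratios)
      show "card D = CARD('a) ^ 3" using D'(2) by (simp add: eval_nat_numeral)
      show "finite R" using R(1) D'(3) finite_subset by blast
    qed (use D'(1) R large(1) in auto)
    then obtain z where z: "z \<in> D" "z \<noteq> 0" "\<forall>a. \<exists>i\<in>?S. z i = a * c i"
      using R(1) by blast
    have zC: "z \<in> C" using z(1) D(1) by auto
    have wt_z: "hamming_weight z = d"
      using constant_weight[OF D(2) _ z(1,2)] q2 by (simp add: power2_eq_square)
    let ?w = "hamming_weight (off_supp z c)"
    \<comment> \<open>The factor \<open>q\<close> lost by passing to \<open>e - f\<close> is
      regained from the \<open>CARD('a)\<close> in front of the union; \<open>2 * f \<le> e\<close>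
      keeps the subtractions exact.\<close>
    have "p ^ (e - f + 1 - f) dvd ?w"
    proof (rule IH)
      have "p ^ f * p ^ (e - f) dvd d" using d(2) e by (simp add: power_add[symmetric])
      then show "p ^ (e - f) dvd d div CARD('a)"
        using q p by (simp add: dvd_div_iff_mult q1[unfolded q] prime_gt_0_nat mult.commute)
      show "1 \<le> d div CARD('a)" using d(1) q1 by (simp add: dvd_imp_le div_greater_zero_iff Suc_le_eq)
      show "f \<le> e - f" using large(2) by simp
      show "meets_griesmer k (d div CARD('a)) (off_supp z ` C)"
        by (rule meets_griesmer_residual[OF C d(1) q1 zC wt_z])
    qed (use c in auto)
    then have "CARD('a) * p ^ (e - f + 1 - f) dvd CARD('a) * ?w" by (rule mult_dvd_mono[OF dvd_refl])
    moreover have "CARD('a) * p ^ (e - f + 1 - f) = p ^ (e + 1 - f)"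
      using large(2) unfolding q by (simp add: power_add[symmetric])
    ultimately have "p ^ (e + 1 - f) dvd CARD('a) * ?w" by (simp only:)
    moreover have "p ^ (e + 1 - f) dvd d"
      using f by (intro dvd_trans[OF le_imp_power_dvd d(2)]) simp
    \<comment> \<open>The union of the two supports has size \<open>d + ?w\<close>.\<close>
    ultimately have union: "p ^ (e + 1 - f) dvd CARD('a) * card {i. z i \<noteq> 0 \<or> c i \<noteq> 0}"
      using card_union_supp[OF C'(7)[OF c] C'(7)[OF zC]] wt_z
      by (simp add: disj_commute distrib_left)
    show ?thesis
      by (rule weight_dvd_of_all_ratios[OF C'(1,3) c zC z(3) van union])
  qed
qed

theorem theorem6p3:
  fixes p f q :: nat
  assumes "prime p" and "f \<ge> 1" and "q = p ^ f" and "CARD('a::{field,finite}) = q"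
    and "\<forall>k d e. \<forall>C :: (nat \<Rightarrow> 'a) set.
           1 \<le> k \<and> k \<le> q - 1 \<and> 1 \<le> d \<and> p ^ e dvd d \<and> p ^ e \<ge> q \<and> griesmer_code k d C \<longrightarrow>
           (\<forall>c\<in>C. p ^ (e + 1) div q dvd hamming_weight c)"
  shows "\<forall>k d e. \<forall>C :: (nat \<Rightarrow> 'a) set.
           1 \<le> k \<and> 1 \<le> d \<and> p ^ e dvd d \<and> p ^ e \<ge> q \<and> griesmer_code k d C \<longrightarrow>
           (\<forall>c\<in>C. p ^ (e + 1) div q dvd hamming_weight c)"
proof -
  have p1: "p > 1" using assms(1) by (rule prime_gt_1_nat)
  have quot: "p ^ (e + 1) div q = p ^ (e + 1 - f)" if "f \<le> e" for e
    using that p1 unfolding assms(3) by (simp add: power_diff)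
  have q_le: "q \<le> p ^ e \<longleftrightarrow> f \<le> e" for e
    using p1 by (simp add: assms(3))
  \<comment> \<open>The induction runs over \<open>meets_griesmer\<close>, which holds for the
    shortened and residual codes as they stand, and starts from the zero code.\<close>
  have main: "p ^ (e + 1 - f) dvd hamming_weight c"
    if "1 \<le> d" "p ^ e dvd d" "f \<le> e" "meets_griesmer k d C" "c \<in> C"
    for k d e c and C :: "(nat \<Rightarrow> 'a) set"
    using that
  proof (induction k arbitrary: d e C c)
    case 0
    then have "card C = 1" "0 \<in> C"
      using meets_griesmerD(1,2)[OF 0(4)] fvec.subspace_0 by auto
    then have "c = 0" using 0(5) by (auto simp: card_1_singleton_iff)
    then show ?case by (simp add: hamming_weight_def)
  next
    case (Suc k)
    show ?case
    proof (cases "q \<le> Suc k")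
      case True
      then show ?thesis
        using griesmer_divisibility_step[OF assms(1) _ Suc.IH _ Suc.prems] assms(3,4) by simp
    next
      \<comment> \<open>Now \<open>Suc k \<le> q - 1\<close>, so the hypothesis applies to an
        equivalent code whose weights include those of \<open>C\<close>.\<close>
      case False
      obtain C' :: "(nat \<Rightarrow> 'a) set" where C': "griesmer_code (Suc k) d C'" "hamming_weight ` C \<subseteq> hamming_weight ` C'"
        using ex_equivalent_griesmer_code[OF Suc.prems(4)] by blast
      obtain c' where c': "c' \<in> C'" "hamming_weight c' = hamming_weight c"
        using C'(2) Suc.prems(5) by (metis imageE image_subset_iff)
      have "p ^ (e + 1) div q dvd hamming_weight c'"
        using assms(5)[rule_format, of "Suc k" d e C' c'] C'(1) c'(1) Suc.prems(1-3) False q_le[of e]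
        by simp
      then show ?thesis using quot[OF Suc.prems(3)] c'(2) by simp
    qed
  qed
  show ?thesis
    using main meets_griesmer_of_griesmer_code quot q_le by (metis (no_types, lifting))
qed

end
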